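(* Let $\Sigma$ be a compact connected Riemann surface of genus at least $2$, with Deligne–Hitchin moduli space $\pi\colon\mathcal M_{DH}\to\mathbb{C}P^1$ (rank $2$, trivial determinant). Let $s$ be an irreducible preferred section of $\pi$. Then $s$ is $\tau$-negative.
   Context: Setting. $E=\Sigma\times\mathbb C^2$ is the trivial $C^\infty$ bundle with standard Hermitian metric and volume form; all connections, Dolbeault operators, etc. on $E$ induce the trivial ones on $\det E$. Gauge transformations act on the right: $\nabla.g=g^{-1}\circ\nabla\circ g$. $\mathcal M_{SD}^{irr}$ is the moduli space (mod $SU(2)$-gauge) of irreducible solutions $(\nabla,\Phi)$, $\nabla$ an $SU(2)$-connection and $\Phi\in\Omega^{1,0}(\Sigma,\mathfrak{sl}(E))$, of Hitchin's self-duality equations $F^\nabla+[\Phi\wedge\Phi^*]=0$, $\bar\partial^\nabla\Phi=0$; it is a hyper-Kähler manifold. $\mathcal M_{DH}$ is its twistor space; as a smooth manifold $\mathcal M_{DH}=\mathcal M_{SD}^{irr}\times\mathbb{C}P^1$, with holomorphic projection $\pi$ to $\mathbb{C}P^1$. A $\lambda$-connection ($\lambda\in\mathbb C$) on $E$ is a pair $(\bar\partial,D)$ with $\bar\partial$ a Dolbeault operator on $E$ and $D\colon\Gamma(E)\to\Omega^{1,0}(E)$ satisfying $D(fs)=\lambda\,\partial f\otimes s+fDs$, $D\bar\partial+\bar\partial D=0$, inducing $\bar\partial$ and $\lambda\partial$ on $\det E$. It is irreducible if there is no $D$-invariant holomorphic line subbundle. Via $(\nabla,\Phi,\lambda)\mapsto(\bar\partial^\nabla+\lambda\Phi^*,\lambda\partial^\nabla+\Phi,\lambda)$,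 $\pi^{-1}(\mathbb C)$ is the moduli space (mod $SL(2,\mathbb C)$-gauge) $\mathcal M_{Hod}(\Sigma)$ of triples $(\bar\partial,D,\lambda)$ with $(\bar\partial,D)$ an irreducible $\lambda$-connection for $\lambda\ne0$ and a stable Higgs bundle for $\lambda=0$. For $\lambda\neq0$, $(\bar\partial,D,\lambda)$ corresponds to the flat connection $\bar\partial+\lambda^{-1}D$. Likewise $\pi^{-1}(\mathbb{C}P^1\setminus\{0\})=\mathcal M_{Hod}(\overline\Sigma)$, glued over $\mathbb C^*$ by $(\bar\partial,D,\lambda)\sim(\lambda^{-1}D,\lambda^{-1}\bar\partial,\lambda^{-1})$. A lift of a holomorphic section $s$ over $\mathbb C$ is a holomorphic family of $\lambda$-connections $(\bar\partial(\lambda),D(\lambda),\lambda)$ representing $s(\lambda)$, $\lambda\in\mathbb C$, also written as the family of flat connections $\nabla^\lambda=\bar\partial(\lambda)+\lambda^{-1}D(\lambda)$, $\lambda\in\mathbb C^*$; lifts over $\mathbb{C}P^1\setminus\{0\}$ are defined analogously using $\overline\Sigma$ and the coordinate $\lambda^{-1}$. Irreducible section: $s(\lambda)$ is irreducible for all $\lambda\ne0,\infty$, and the Higgs bundles $s(0)$ on $\Sigma$, $s(\infty)$ on $\overline\Sigma$ are stable. Parity: for an irreducible section with lifts ${}^+\nabla^\lambda$ over $\mathbb C$ and ${}^-\nabla^\lambda$ over $\mathbb{C}P^1\setminus\{0\}$ there is a family $g(\lambda)$, $\lambda\in\mathbb C^*$, of $GL(2,\mathbb C)$-gauge transformations, holomorphic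 in $\lambda$, with ${}^+\nabla^\lambda.g(\lambda)={}^-\nabla^\lambda$; the parity of $s$ in $\mathbb Z/2\mathbb Z$ is the parity of the degree (winding number) of $\lambda\mapsto\det g(\lambda)\in\mathbb C^*$ (well defined). Sections given by solutions of the self-duality equations have parity $0$. $\tau$-real sections: $\tau\colon\mathcal M_{DH}\to\mathcal M_{DH}$, $\tau(\nabla,\Phi,\lambda)=(\nabla,\Phi,-\bar\lambda^{-1})$, is an antiholomorphic involution covering $\tilde\tau(\lambda)=-\bar\lambda^{-1}$. A section $s$ is $\tau$-real if $s(\lambda)=\tau(s(-\bar\lambda^{-1}))$ for all $\lambda$; for a lift $\nabla^\lambda$ this means that for each $\lambda\in\mathbb C^*$ there is a gauge transformation $g(\lambda)$ with $\nabla^\lambda.g(\lambda)=\overline{\nabla^{-\bar\lambda^{-1}}}$ (complex conjugate connection on $\Sigma\times\mathbb C^2$). If $s$ is irreducible of parity $0$, $g(\lambda)$ can be chosen $SL(2,\mathbb C)$-valued and holomorphic in $\lambda$, uniquely up to sign, and then $g(\lambda)\overline{g(-\bar\lambda^{-1})}=\pm\mathrm{Id}$ with sign independent of choices; $s$ is called $\tau$-positive if the sign is $+$ and $\tau$-negative if it is $-$. Preferred section: a $\tau$-real section given by the family of $\lambda$-connections $(\bar\partial^\nabla+\lambda\Phi^*,\lambda\partial^\nabla+\Phi,\lambda)$, i.e. by the flat connections $\nabla+\lambda^{-1}\Phi+\lambda\Phi^*$, for some solution $(\nabla,\Phi)$ of the self-duality equations. *)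

theory Defs
  imports
    "HOL-Complex_Analysis.Complex_Analysis"
    "HOL-Library.Z2"
    "HOL-Library.Function_Algebras"
begin

section \<open>Smooth functions and compact Riemann surfaces\<close>

primrec Ck_on :: "nat \<Rightarrow> 'v::real_normed_vector set \<Rightarrow> ('v \<Rightarrow> 'w::real_normed_vector) \<Rightarrow> bool" where
  "Ck_on 0 S f \<longleftrightarrow> continuous_on S f"
| "Ck_on (Suc k) S f \<longleftrightarrow>
     (\<forall>x\<in>S. f differentiable (at x)) \<and> (\<forall>v. Ck_on k S (\<lambda>x. frechet_derivative f (at x) v))"

text \<open>Real smoothness (only used on open subsets of finite-dimensional spaces).\<close>

definition Cinf_on :: "'v::real_normed_vector set \<Rightarrow> ('v \<Rightarrow> 'w::real_normed_vector) \<Rightarrow> bool" where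
  "Cinf_on S f \<longleftrightarrow> (\<forall>k. Ck_on k S f)"

text \<open>A chart is a pair (domain, coordinate function); a surface is given by an atlas on a
  topological space which is the whole type.\<close>

type_synonym 'a chart = "'a set \<times> ('a \<Rightarrow> complex)"

definition chart_inv :: "'a chart \<Rightarrow> complex \<Rightarrow> 'a" where
  "chart_inv c = inv_into (fst c) (snd c)"

definition riemann_surface :: "'a::t2_space chart set \<Rightarrow> bool" where
  "riemann_surface A \<longleftrightarrow>
     (\<Union>c\<in>A. fst c) = UNIV \<and>
     (\<forall>c\<in>A. open (fst c) \<and> open (snd c ` fst c) \<and>
        homeomorphism (fst c) (snd c ` fst c) (snd c) (chart_inv c)) \<and>
     (\<forall>c\<in>A. \<forall>c'\<in>A. (snd c' \<circ> chart_inv c) holomorphic_on (snd c ` (fst c \<inter> fst c')))"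

definition compact_connected_riemann_surface :: "'a::t2_space chart set \<Rightarrow> bool" where
  "compact_connected_riemann_surface A \<longleftrightarrow>
     riemann_surface A \<and> compact (UNIV :: 'a set) \<and> connected (UNIV :: 'a set)"

text \<open>The conjugate surface.\<close>

definition conj_chart :: "'a chart \<Rightarrow> 'a chart" where
  "conj_chart c = (fst c, cnj \<circ> snd c)"

definition conj_atlas :: "'a chart set \<Rightarrow> 'a chart set" where
  "conj_atlas A = conj_chart ` A"

text \<open>Holomorphic 1-forms: \<open>\<omega> = \<omega>\<^sub>c dz\<^sub>c\<close> in the chart \<open>c\<close>. The coefficients are set to zero where they
  carry no information, so that these families form a vector space isomorphic to the space
  of holomorphic 1-forms; its dimension is the genus.\<close>

definition holomorphic_one_form ::
    "'a::t2_space chart set \<Rightarrow> ('a chart \<Rightarrow> 'a \<Rightarrow> complex) \<Rightarrow> bool" where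
  "holomorphic_one_form A \<omega> \<longleftrightarrow>
     (\<forall>c p. \<not> (c \<in> A \<and> p \<in> fst c) \<longrightarrow> \<omega> c p = 0) \<and>
     (\<forall>c\<in>A. (\<omega> c \<circ> chart_inv c) holomorphic_on (snd c ` fst c)) \<and>
     (\<forall>c\<in>A. \<forall>c'\<in>A. \<forall>p\<in>fst c \<inter> fst c'.
        \<omega> c p = deriv (snd c' \<circ> chart_inv c) (snd c p) * \<omega> c' p)"

definition genus :: "'a::t2_space chart set \<Rightarrow> nat" where
  "genus A = vector_space.dim (\<lambda>(k::complex) \<omega> c p. k * \<omega> c p) {\<omega>. holomorphic_one_form A \<omega>}"

definition smooth_on :: "'a::t2_space chart set \<Rightarrow> 'a set \<Rightarrow> ('a \<Rightarrow> 'w::real_normed_vector) \<Rightarrow> bool" where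
  "smooth_on A V f \<longleftrightarrow> (\<forall>c\<in>A. Cinf_on (snd c ` (V \<inter> fst c)) (f \<circ> chart_inv c))"


section \<open>Matrix-valued forms and operators on the trivial bundle\<close>

type_synonym cmat = "complex^2^2"

definition cscale :: "complex \<Rightarrow> cmat \<Rightarrow> cmat" where
  "cscale k = map_matrix ((*) k)"

definition conj_mat :: "cmat \<Rightarrow> cmat" where
  "conj_mat = map_matrix cnj"

definition adj_mat :: "cmat \<Rightarrow> cmat" where
  "adj_mat M = conj_mat (transpose M)"

definition GL2 :: "cmat set" where "GL2 = {M. invertible M}"
definition SL2 :: "cmat set" where "SL2 = {M. det M = 1}"
definition SU2 :: "cmat set" where "SU2 = {M. det M = 1 \<and> M ** adj_mat M = mat 1}"

text \<open>A matrix-valued form of type (1,0) or (0,1) is given by its coefficients \<open>\<gamma> c\<close> with respect to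
  \<open>dz\<^sub>c\<close>, respectively to the conjugate of \<open>dz\<^sub>c\<close>. Values at points outside the domain of \<open>c\<close>, or for
  \<open>c\<close> outside the atlas, are irrelevant.\<close>

type_synonym 'a mform = "'a chart \<Rightarrow> 'a \<Rightarrow> cmat"

definition form10 :: "'a::t2_space chart set \<Rightarrow> 'a mform \<Rightarrow> bool" where
  "form10 A \<gamma> \<longleftrightarrow> (\<forall>c\<in>A. smooth_on A (fst c) (\<gamma> c)) \<and>
     (\<forall>c\<in>A. \<forall>c'\<in>A. \<forall>p\<in>fst c \<inter> fst c'.
        \<gamma> c p = cscale (deriv (snd c' \<circ> chart_inv c) (snd c p)) (\<gamma> c' p))"

definition form01 :: "'a::t2_space chart set \<Rightarrow> 'a mform \<Rightarrow> bool" where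
  "form01 A \<gamma> \<longleftrightarrow> (\<forall>c\<in>A. smooth_on A (fst c) (\<gamma> c)) \<and>
     (\<forall>c\<in>A. \<forall>c'\<in>A. \<forall>p\<in>fst c \<inter> fst c'.
        \<gamma> c p = cscale (cnj (deriv (snd c' \<circ> chart_inv c) (snd c p))) (\<gamma> c' p))"

definition trace_free :: "'a chart set \<Rightarrow> 'a mform \<Rightarrow> bool" where
  "trace_free A \<gamma> \<longleftrightarrow> (\<forall>c\<in>A. \<forall>p\<in>fst c. trace (\<gamma> c p) = 0)"

text \<open>The pair \<open>(\<alpha>, \<beta>)\<close> of a (0,1)-form and a (1,0)-form stands, for given \<open>l\<close>, for the pair of
  operators whose coefficients in a chart are \<open>\<partial>/\<partial>\<zeta> + \<alpha>\<^sub>c\<close> (with \<open>\<zeta>\<close> the conjugate of \<open>z\<^sub>c\<close>) and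
  \<open>l \<partial>/\<partial>z\<^sub>c + \<beta>\<^sub>c\<close>. On the trivial bundle every Dolbeault operator, and every operator with the
  Leibniz rule of a \<open>\<lambda>\<close>-connection, is of this form. A connection is the case \<open>l = 1\<close>.\<close>

type_synonym 'a conn = "'a mform \<times> 'a mform"

definition wirtinger :: "'a chart \<Rightarrow> ('a \<Rightarrow> complex^2) \<Rightarrow> 'a \<Rightarrow> complex^2" where
  "wirtinger c f p =
     (let F' = frechet_derivative (f \<circ> chart_inv c) (at (snd c p))
      in (1/2) *s (F' 1 - \<i> *s F' \<i>))"

definition wirtinger_bar :: "'a chart \<Rightarrow> ('a \<Rightarrow> complex^2) \<Rightarrow> 'a \<Rightarrow> complex^2" where
  "wirtinger_bar c f p =
     (let F' = frechet_derivative (f \<circ> chart_inv c) (at (snd c p))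
      in (1/2) *s (F' 1 + \<i> *s F' \<i>))"

definition dbar_op :: "'a mform \<Rightarrow> 'a chart \<Rightarrow> ('a \<Rightarrow> complex^2) \<Rightarrow> 'a \<Rightarrow> complex^2" where
  "dbar_op \<alpha> c \<sigma> p = wirtinger_bar c \<sigma> p + \<alpha> c p *v \<sigma> p"

definition D_op :: "complex \<Rightarrow> 'a mform \<Rightarrow> 'a chart \<Rightarrow> ('a \<Rightarrow> complex^2) \<Rightarrow> 'a \<Rightarrow> complex^2" where
  "D_op l \<beta> c \<sigma> p = l *s wirtinger c \<sigma> p + \<beta> c p *v \<sigma> p"

definition mul_op :: "'a mform \<Rightarrow> 'a chart \<Rightarrow> ('a \<Rightarrow> complex^2) \<Rightarrow> 'a \<Rightarrow> complex^2" where
  "mul_op \<phi> c \<sigma> p = \<phi> c p *v \<sigma> p"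

text \<open>The sign in \<open>D dbar + dbar D = 0\<close> turns into a commutator on coefficients, since 1-forms
  anticommute. The operator induced on the determinant bundle is the trivial one
  plus the trace of the matrix-valued form.\<close>

definition lambda_connection :: "'a::t2_space chart set \<Rightarrow> complex \<Rightarrow> 'a conn \<Rightarrow> bool" where
  "lambda_connection A l C \<longleftrightarrow> (case C of (\<alpha>, \<beta>) \<Rightarrow>
     form01 A \<alpha> \<and> form10 A \<beta> \<and> trace_free A \<alpha> \<and> trace_free A \<beta> \<and>
     (\<forall>\<sigma>. smooth_on A UNIV \<sigma> \<longrightarrow> (\<forall>c\<in>A. \<forall>p\<in>fst c.
        D_op l \<beta> c (dbar_op \<alpha> c \<sigma>) p = dbar_op \<alpha> c (D_op l \<beta> c \<sigma>) p)))"

text \<open>\<open>gauge_by A l g C C'\<close>: \<open>C.g = C'\<close> for the right action by conjugation of operators.\<close>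

definition gauge_by ::
    "'a::t2_space chart set \<Rightarrow> complex \<Rightarrow> ('a \<Rightarrow> cmat) \<Rightarrow> 'a conn \<Rightarrow> 'a conn \<Rightarrow> bool" where
  "gauge_by A l g C C' \<longleftrightarrow> (case (C, C') of ((\<alpha>, \<beta>), (\<alpha>', \<beta>')) \<Rightarrow>
     (\<forall>\<sigma>. smooth_on A UNIV \<sigma> \<longrightarrow> (\<forall>c\<in>A. \<forall>p\<in>fst c.
        dbar_op \<alpha>' c \<sigma> p = matrix_inv (g p) *v dbar_op \<alpha> c (\<lambda>q. g q *v \<sigma> q) p \<and>
        D_op l \<beta>' c \<sigma> p = matrix_inv (g p) *v D_op l \<beta> c (\<lambda>q. g q *v \<sigma> q) p)))"

definition gauge_equiv ::
    "'a::t2_space chart set \<Rightarrow> complex \<Rightarrow> 'a conn \<Rightarrow> 'a conn \<Rightarrow> bool" where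
  "gauge_equiv A l C C' \<longleftrightarrow>
     (\<exists>g. smooth_on A UNIV g \<and> (\<forall>p. g p \<in> SL2) \<and> gauge_by A l g C C')"


section \<open>Line subbundles, irreducibility and stability\<close>

definition line_subbundle :: "'a::t2_space chart set \<Rightarrow> ('a \<Rightarrow> (complex^2) set) \<Rightarrow> bool" where
  "line_subbundle A L \<longleftrightarrow>
     (\<forall>p. \<exists>V v. open V \<and> p \<in> V \<and> smooth_on A V v \<and>
        (\<forall>q\<in>V. v q \<noteq> 0 \<and> L q = range (\<lambda>k. k *s v q)))"

definition preserves ::
    "'a::t2_space chart set \<Rightarrow> ('a chart \<Rightarrow> ('a \<Rightarrow> complex^2) \<Rightarrow> 'a \<Rightarrow> complex^2) \<Rightarrow>
     ('a \<Rightarrow> (complex^2) set) \<Rightarrow> bool" where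
  "preserves A P L \<longleftrightarrow>
     (\<forall>V \<sigma>. open V \<and> smooth_on A V \<sigma> \<and> (\<forall>q\<in>V. \<sigma> q \<in> L q) \<longrightarrow>
        (\<forall>c\<in>A. \<forall>q\<in>V \<inter> fst c. P c \<sigma> q \<in> L q))"

definition holomorphic_line_subbundle ::
    "'a::t2_space chart set \<Rightarrow> 'a mform \<Rightarrow> ('a \<Rightarrow> (complex^2) set) \<Rightarrow> bool" where
  "holomorphic_line_subbundle A \<alpha> L \<longleftrightarrow> line_subbundle A L \<and> preserves A (dbar_op \<alpha>) L"

definition irreducible_lambda_connection ::
    "'a::t2_space chart set \<Rightarrow> complex \<Rightarrow> 'a conn \<Rightarrow> bool" where
  "irreducible_lambda_connection A l C \<longleftrightarrow> lambda_connection A l C \<and> (case C of (\<alpha>, \<beta>) \<Rightarrow>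
     \<not> (\<exists>L. holomorphic_line_subbundle A \<alpha> L \<and> preserves A (D_op l \<beta>) L))"

text \<open>\<open>has_degree A \<alpha> L n\<close>: the holomorphic line bundle \<open>L\<close> has a nonzero meromorphic section \<open>\<sigma>\<close>, of order
  \<open>m p\<close> at each point \<open>p\<close>, whose divisor has degree \<open>n\<close>; locally \<open>\<sigma> = (z - z(p))^(m p) v\<close> with a
  holomorphic frame \<open>v\<close> of \<open>L\<close>. The value of \<open>\<sigma>\<close> at its zeros and poles is irrelevant.\<close>

definition has_degree ::
    "'a::t2_space chart set \<Rightarrow> 'a mform \<Rightarrow> ('a \<Rightarrow> (complex^2) set) \<Rightarrow> int \<Rightarrow> bool" where
  "has_degree A \<alpha> L n \<longleftrightarrow>
     (\<exists>\<sigma> m. finite {p. m p \<noteq> 0} \<and> n = (\<Sum>p | m p \<noteq> 0. m p) \<and>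
        (\<forall>c\<in>A. \<forall>p\<in>fst c. \<exists>V v. open V \<and> p \<in> V \<and> V \<subseteq> fst c \<and> smooth_on A V v \<and>
           (\<forall>q\<in>V. v q \<noteq> 0 \<and> v q \<in> L q \<and> dbar_op \<alpha> c v q = 0 \<and>
              (q \<noteq> p \<longrightarrow> \<sigma> q = ((snd c q - snd c p) powi m p) *s v q))))"

text \<open>The determinant being trivial, the slope of the whole bundle is zero.\<close>

definition stable_higgs_bundle :: "'a::t2_space chart set \<Rightarrow> 'a conn \<Rightarrow> bool" where
  "stable_higgs_bundle A C \<longleftrightarrow> lambda_connection A 0 C \<and> (case C of (\<alpha>, \<phi>) \<Rightarrow>
     (\<forall>L n. holomorphic_line_subbundle A \<alpha> L \<and> preserves A (mul_op \<phi>) L \<and> has_degree A \<alpha> L n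
        \<longrightarrow> n < 0))"


section \<open>The self-duality equations\<close>

text \<open>A triple \<open>(\<alpha>, \<beta>, \<phi>)\<close>: the connection with (0,1)-part \<open>\<alpha>\<close> and (1,0)-part \<open>\<beta>\<close>, and the Higgs field.\<close>

type_synonym 'a pair = "'a mform \<times> 'a mform \<times> 'a mform"

definition adj_form :: "'a mform \<Rightarrow> 'a mform" where
  "adj_form \<phi> = (\<lambda>c p. adj_mat (\<phi> c p))"

text \<open>The two equations are written as operator identities for the coefficients of
  \<open>dz \<and> dz'\<close>, where \<open>dz'\<close> is the conjugate of \<open>dz\<close>.\<close>

definition sd_solution :: "'a::t2_space chart set \<Rightarrow> 'a pair \<Rightarrow> bool" where
  "sd_solution A S \<longleftrightarrow> (case S of (\<alpha>, \<beta>, \<phi>) \<Rightarrow>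
     form01 A \<alpha> \<and> form10 A \<beta> \<and> form10 A \<phi> \<and>
     trace_free A \<alpha> \<and> trace_free A \<beta> \<and> trace_free A \<phi> \<and>
     (\<forall>c\<in>A. \<forall>p\<in>fst c. \<alpha> c p = - adj_mat (\<beta> c p)) \<and>
     (\<forall>\<sigma>. smooth_on A UNIV \<sigma> \<longrightarrow> (\<forall>c\<in>A. \<forall>p\<in>fst c.
        (D_op 1 \<beta> c (dbar_op \<alpha> c \<sigma>) p - dbar_op \<alpha> c (D_op 1 \<beta> c \<sigma>) p)
          + (\<phi> c p ** adj_mat (\<phi> c p) - adj_mat (\<phi> c p) ** \<phi> c p) *v \<sigma> p = 0 \<and>
        dbar_op \<alpha> c (mul_op \<phi> c \<sigma>) p - mul_op \<phi> c (dbar_op \<alpha> c \<sigma>) p = 0)))"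

text \<open>A solution is reducible if it is an orthogonal direct sum, i.e. if some line subbundle and its
  orthogonal complement are both invariant under the connection and the Higgs field.
  (A parallel line subbundle that is only invariant under \<open>\<phi>\<close> does not suffice.)\<close>

definition orth :: "('a \<Rightarrow> (complex^2) set) \<Rightarrow> 'a \<Rightarrow> (complex^2) set" where
  "orth L p = {w. \<forall>v\<in>L p. (\<Sum>i\<in>UNIV. v $ i * cnj (w $ i)) = 0}"

definition sd_irreducible :: "'a::t2_space chart set \<Rightarrow> 'a pair \<Rightarrow> bool" where
  "sd_irreducible A S \<longleftrightarrow> (case S of (\<alpha>, \<beta>, \<phi>) \<Rightarrow>
     \<not> (\<exists>L. line_subbundle A L \<and>
          (\<forall>M\<in>{L, orth L}. preserves A (dbar_op \<alpha>) M \<and> preserves A (D_op 1 \<beta>) M \<and>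
             preserves A (mul_op \<phi>) M)))"

text \<open>The condition on \<open>\<phi>\<close> is that of \<open>gauge_by\<close> with \<open>l = 0\<close>, as \<open>D_op 0 \<phi>\<close> is multiplication by \<open>\<phi>\<close>.\<close>

definition sd_gauge_rel :: "'a::t2_space chart set \<Rightarrow> ('a pair \<times> 'a pair) set" where
  "sd_gauge_rel A = {((\<alpha>, \<beta>, \<phi>), (\<alpha>', \<beta>', \<phi>')).
     \<exists>g. smooth_on A UNIV g \<and> (\<forall>p. g p \<in> SU2) \<and>
       gauge_by A 1 g (\<alpha>, \<beta>) (\<alpha>', \<beta>') \<and> gauge_by A 0 g (\<alpha>, \<phi>) (\<alpha>', \<phi>')}"

definition M_SD_irr :: "'a::t2_space chart set \<Rightarrow> 'a pair set set" where
  "M_SD_irr A = {S. sd_solution A S \<and> sd_irreducible A S} // sd_gauge_rel A"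


section \<open>The Deligne--Hitchin moduli space and its sections\<close>

text \<open>The complex projective line, \<open>Pt \<lambda>\<close> being the point with affine coordinate \<open>\<lambda>\<close>.\<close>

datatype cp1 = Pt complex | Infty

definition antipode :: "cp1 \<Rightarrow> cp1" where
  "antipode x = (case x of Infty \<Rightarrow> Pt 0
     | Pt l \<Rightarrow> if l = 0 then Infty else Pt (- inverse (cnj l)))"

definition M_DH :: "'a::t2_space chart set \<Rightarrow> ('a pair set \<times> cp1) set" where
  "M_DH A = M_SD_irr A \<times> UNIV"

definition tau :: "'a pair set \<times> cp1 \<Rightarrow> 'a pair set \<times> cp1" where
  "tau X = (fst X, antipode (snd X))"

text \<open>A (0,1)-form on a surface is a (1,0)-form on the conjugate surface and vice versa; as a family of
  coefficients it only has to be reindexed.\<close>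

definition to_conj :: "'a mform \<Rightarrow> 'a mform" where
  "to_conj \<gamma> = (\<lambda>c. \<gamma> (conj_chart c))"

definition scale_form :: "complex \<Rightarrow> 'a mform \<Rightarrow> 'a mform" where
  "scale_form k \<gamma> = (\<lambda>c p. cscale k (\<gamma> c p))"

definition add_form :: "'a mform \<Rightarrow> 'a mform \<Rightarrow> 'a mform" where
  "add_form \<gamma> \<delta> = (\<lambda>c p. \<gamma> c p + \<delta> c p)"

text \<open>The \<open>\<lambda>\<close>-connection of a solution, and the corresponding \<open>\<mu>\<close>-connection on the conjugate surface,
  \<open>\<mu> = 1/\<lambda>\<close>, obtained from it through \<open>(dbar, D, \<lambda>) \<sim> (D/\<lambda>, dbar/\<lambda>, 1/\<lambda>)\<close>.\<close>

definition hodge :: "'a pair \<Rightarrow> complex \<Rightarrow> 'a conn" where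
  "hodge S l = (case S of (\<alpha>, \<beta>, \<phi>) \<Rightarrow>
     (add_form \<alpha> (scale_form l (adj_form \<phi>)), add_form (scale_form l \<beta>) \<phi>))"

definition hodge_conj :: "'a pair \<Rightarrow> complex \<Rightarrow> 'a conn" where
  "hodge_conj S m = (case S of (\<alpha>, \<beta>, \<phi>) \<Rightarrow>
     (to_conj (add_form \<beta> (scale_form m \<phi>)), to_conj (add_form (scale_form m \<alpha>) (adj_form \<phi>))))"

definition represents ::
    "'a::t2_space chart set \<Rightarrow> (cp1 \<Rightarrow> 'a pair set \<times> cp1) \<Rightarrow> complex \<Rightarrow> 'a conn \<Rightarrow> bool" where
  "represents A s l C \<longleftrightarrow> lambda_connection A l C \<and>
     (\<exists>S\<in>fst (s (Pt l)). gauge_equiv A l (hodge S l) C)"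

definition represents_conj ::
    "'a::t2_space chart set \<Rightarrow> (cp1 \<Rightarrow> 'a pair set \<times> cp1) \<Rightarrow> complex \<Rightarrow> 'a conn \<Rightarrow> bool" where
  "represents_conj A s m C \<longleftrightarrow> lambda_connection (conj_atlas A) m C \<and>
     (\<exists>S\<in>fst (s (if m = 0 then Infty else Pt (inverse m))).
        gauge_equiv (conj_atlas A) m (hodge_conj S m) C)"

text \<open>Holomorphic dependence on a parameter of (the coefficients of) forms: holomorphic in the parameter
  and jointly smooth.\<close>

definition holomorphic_form_family ::
    "'a::t2_space chart set \<Rightarrow> complex set \<Rightarrow> (complex \<Rightarrow> 'a mform) \<Rightarrow> bool" where
  "holomorphic_form_family A W \<gamma> \<longleftrightarrow>
     (\<forall>c\<in>A. Cinf_on (W \<times> (snd c ` fst c)) (\<lambda>(l, z). \<gamma> l c (chart_inv c z)) \<and>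
        (\<forall>p\<in>fst c. \<forall>i j. (\<lambda>l. \<gamma> l c p $ i $ j) holomorphic_on W))"

definition holomorphic_gauge_family ::
    "'a::t2_space chart set \<Rightarrow> complex set \<Rightarrow> (complex \<Rightarrow> 'a \<Rightarrow> cmat) \<Rightarrow> bool" where
  "holomorphic_gauge_family A W g \<longleftrightarrow> holomorphic_form_family A W (\<lambda>l c. g l)"

definition lift_on ::
    "'a::t2_space chart set \<Rightarrow> (cp1 \<Rightarrow> 'a pair set \<times> cp1) \<Rightarrow> complex set \<Rightarrow> (complex \<Rightarrow> 'a conn) \<Rightarrow> bool"
where
  "lift_on A s W F \<longleftrightarrow>
     holomorphic_form_family A W (\<lambda>l. fst (F l)) \<and> holomorphic_form_family A W (\<lambda>l. snd (F l)) \<and>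
     (\<forall>l\<in>W. represents A s l (F l))"

text \<open>Here the parameter is the coordinate \<open>\<mu> = 1/\<lambda>\<close> around \<open>\<infinity>\<close>.\<close>

definition lift_conj_on ::
    "'a::t2_space chart set \<Rightarrow> (cp1 \<Rightarrow> 'a pair set \<times> cp1) \<Rightarrow> complex set \<Rightarrow> (complex \<Rightarrow> 'a conn) \<Rightarrow> bool"
where
  "lift_conj_on A s W F \<longleftrightarrow>
     holomorphic_form_family (conj_atlas A) W (\<lambda>m. fst (F m)) \<and>
     holomorphic_form_family (conj_atlas A) W (\<lambda>m. snd (F m)) \<and>
     (\<forall>m\<in>W. represents_conj A s m (F m))"

text \<open>Holomorphic sections of the projection to the projective line. A map into the moduli space is
  holomorphic iff it is locally represented by holomorphic families.\<close>

definition dh_section :: "'a::t2_space chart set \<Rightarrow> (cp1 \<Rightarrow> 'a pair set \<times> cp1) \<Rightarrow> bool" where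
  "dh_section A s \<longleftrightarrow>
     (\<forall>x. s x \<in> M_DH A \<and> snd (s x) = x) \<and>
     (\<forall>l. \<exists>W F. open W \<and> l \<in> W \<and> lift_on A s W F) \<and>
     (\<forall>m. \<exists>W F. open W \<and> m \<in> W \<and> lift_conj_on A s W F)"

definition irreducible_section :: "'a::t2_space chart set \<Rightarrow> (cp1 \<Rightarrow> 'a pair set \<times> cp1) \<Rightarrow> bool" where
  "irreducible_section A s \<longleftrightarrow> dh_section A s \<and>
     (\<forall>l C. l \<noteq> 0 \<and> represents A s l C \<longrightarrow> irreducible_lambda_connection A l C) \<and>
     (\<forall>C. represents A s 0 C \<longrightarrow> stable_higgs_bundle A C) \<and>
     (\<forall>C. represents_conj A s 0 C \<longrightarrow> stable_higgs_bundle (conj_atlas A) C)"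

definition tau_real :: "'a::t2_space chart set \<Rightarrow> (cp1 \<Rightarrow> 'a pair set \<times> cp1) \<Rightarrow> bool" where
  "tau_real A s \<longleftrightarrow> dh_section A s \<and> (\<forall>x. s x = tau (s (antipode x)))"

definition preferred_section :: "'a::t2_space chart set \<Rightarrow> (cp1 \<Rightarrow> 'a pair set \<times> cp1) \<Rightarrow> bool" where
  "preferred_section A s \<longleftrightarrow> tau_real A s \<and>
     (\<exists>S. sd_solution A S \<and> lift_on A s UNIV (hodge S))"


section \<open>Parity and sign\<close>

text \<open>The families of flat connections on the given surface, for nonzero \<open>\<lambda>\<close>, of a lift over the affine
  line and of a lift around \<open>\<infinity>\<close>. For the latter, the Dolbeault operator of the conjugate surface is the
  (1,0)-part and \<open>\<mu>\<^sup>-\<^sup>1 D = \<lambda> D\<close> is the (0,1)-part.\<close>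

definition flat_family :: "(complex \<Rightarrow> 'a conn) \<Rightarrow> complex \<Rightarrow> 'a conn" where
  "flat_family F l = (fst (F l), scale_form (inverse l) (snd (F l)))"

definition flat_family_conj :: "(complex \<Rightarrow> 'a conn) \<Rightarrow> complex \<Rightarrow> 'a conn" where
  "flat_family_conj F l =
     (to_conj (scale_form l (snd (F (inverse l)))), to_conj (fst (F (inverse l))))"

text \<open>The parity does not depend on the choices. The determinant of \<open>g l\<close> is constant on the surface, so that the
  condition is the same at all points \<open>p\<close>.\<close>

definition has_parity :: "'a::t2_space chart set \<Rightarrow> (cp1 \<Rightarrow> 'a pair set \<times> cp1) \<Rightarrow> bit \<Rightarrow> bool" where
  "has_parity A s b \<longleftrightarrow>
     (\<exists>F G g. lift_on A s UNIV F \<and> lift_conj_on A s UNIV G \<and>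
        holomorphic_gauge_family A (- {0}) g \<and>
        (\<forall>l. l \<noteq> 0 \<longrightarrow> (\<forall>p. g l p \<in> GL2) \<and>
           gauge_by A 1 (g l) (flat_family F l) (flat_family_conj G l)) \<and>
        (\<forall>p. \<exists>n::int. winding_number (\<lambda>t. det (g (circlepath 0 1 t) p)) 0 = of_int n \<and>
           of_int n = b))"

text \<open>The complex conjugate connection: conjugation exchanges the types of forms.\<close>

definition conj_conn :: "'a conn \<Rightarrow> 'a conn" where
  "conj_conn C = ((\<lambda>c p. conj_mat (snd C c p)), (\<lambda>c p. conj_mat (fst C c p)))"

definition tau_gauge ::
    "'a::t2_space chart set \<Rightarrow> (complex \<Rightarrow> 'a conn) \<Rightarrow> (complex \<Rightarrow> 'a \<Rightarrow> cmat) \<Rightarrow> bool" where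
  "tau_gauge A F g \<longleftrightarrow> holomorphic_gauge_family A (- {0}) g \<and>
     (\<forall>l. l \<noteq> 0 \<longrightarrow> (\<forall>p. g l p \<in> SL2) \<and>
        gauge_by A 1 (g l) (flat_family F l) (conj_conn (flat_family F (- inverse (cnj l)))))"

text \<open>The sign: for a lift, such a family \<open>g\<close> exists, and every choice of it (it is unique up to sign) has
  the sign \<open>e\<close>. The sign does not depend on the lift either.\<close>

definition has_tau_sign ::
    "'a::t2_space chart set \<Rightarrow> (cp1 \<Rightarrow> 'a pair set \<times> cp1) \<Rightarrow> complex \<Rightarrow> bool" where
  "has_tau_sign A s e \<longleftrightarrow>
     (\<exists>F. lift_on A s UNIV F \<and> (\<exists>g. tau_gauge A F g) \<and>
        (\<forall>g. tau_gauge A F g \<longrightarrow>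
           (\<forall>l p. l \<noteq> 0 \<longrightarrow> g l p ** conj_mat (g (- inverse (cnj l)) p) = mat e)))"

definition tau_positive :: "'a::t2_space chart set \<Rightarrow> (cp1 \<Rightarrow> 'a pair set \<times> cp1) \<Rightarrow> bool" where
  "tau_positive A s \<longleftrightarrow>
     irreducible_section A s \<and> has_parity A s 0 \<and> tau_real A s \<and> has_tau_sign A s 1"

definition tau_negative :: "'a::t2_space chart set \<Rightarrow> (cp1 \<Rightarrow> 'a pair set \<times> cp1) \<Rightarrow> bool" where
  "tau_negative A s \<longleftrightarrow>
     irreducible_section A s \<and> has_parity A s 0 \<and> tau_real A s \<and> has_tau_sign A s (- 1)"

end

theory Submission
  imports Defs
begin

text \<open>Write \<open>J\<close> for the constant matrix with rows \<open>(0, 1)\<close>, \<open>(-1, 0)\<close>. The map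
  \<open>M \<mapsto> J\<^sup>-\<^sup>1 M' J\<close>, \<open>M'\<close> the complex conjugate of \<open>M\<close>, is minus the adjoint on trace-free matrices, so that the
  constant gauge transformation \<open>J\<close> carries the family \<open>\<nabla> + \<lambda>\<^sup>-\<^sup>1 \<Phi> + \<lambda> \<Phi>\<^sup>*\<close> to the conjugate of its
  value at \<open>-1/\<lambda>'\<close>. As \<open>J J' = J\<^sup>2 = -1\<close>, this choice has sign \<open>-1\<close>. Any other choice is \<open>\<plusminus>J\<close> at each
  \<open>\<lambda>\<close>, since the automorphisms of determinant one of an irreducible \<open>\<lambda>\<close>-connection are \<open>\<plusminus>1\<close>, and by
  continuity the sign does not depend on \<open>\<lambda>\<close>.

  For the parity, the same solution should give a lift around \<open>\<infinity>\<close>, glued to the first one by the identity.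
  At \<open>\<infinity>\<close> itself this would require the uniqueness of solutions for a given stable Higgs bundle; it is
  avoided by using reality: the quaternionic structure turns a gauge equivalence at
  \<open>-\<mu>'\<close> into one of the operators on the conjugate surface at \<open>\<mu>\<close>, and \<open>s\<close> has the same underlying
  class of solutions at the antipodal points \<open>\<lambda> = -\<mu>'\<close> and \<open>\<lambda> = 1/\<mu>\<close>.\<close>

section \<open>Smooth maps in charts\<close>

text \<open>On an open set, equality of \<open>f\<close> and \<open>g\<close> forces equality of
  their derivatives there, so the induction passes to directional derivatives.\<close>

lemma Ck_on_cong:
  assumes "open S" "\<And>x. x \<in> S \<Longrightarrow> f x = g x" "Ck_on k S f"
  shows "Ck_on k S g"
  using assms
proof (induction k arbitrary: f g)
  case 0
  then show ?case by (simp cong: continuous_on_cong)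
next
  case (Suc k)
  have D: "frechet_derivative f (at x) = frechet_derivative g (at x)" if "x \<in> S" for x
    using Suc.prems that by (intro frechet_derivative_transform_within_open) auto
  have "g differentiable at x" if x: "x \<in> S" for x
  proof -
    obtain D where "(f has_derivative D) (at x)"
      using Suc.prems(3) x by (auto simp: differentiable_def)
    then have "(g has_derivative D) (at x)"
      by (rule has_derivative_transform_within_open) (use Suc.prems that in auto)
    then show ?thesis by (auto simp: differentiable_def)
  qed
  moreover have "Ck_on k S (\<lambda>x. frechet_derivative g (at x) v)" for v
  proof (rule Suc.IH[OF Suc.prems(1)])
    show "Ck_on k S (\<lambda>x. frechet_derivative f (at x) v)"
      using Suc.prems(3) by simp
  qed (simp add: D)
  ultimately show ?case by simp
qed

lemma Ck_on_const: "open S \<Longrightarrow> Ck_on k S (\<lambda>x. b)"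
  by (induction k arbitrary: b) auto

text \<open>By the chain rule a directional derivative has the same shape again, with
  \<open>b = 0\<close>; hence \<open>f\<close> and \<open>b\<close> vary in the induction. It serves
  restriction to smaller open sets, conjugated coordinates, slices of families, and real linear maps
  of the values.\<close>

lemma Ck_on_affine:
  assumes "Ck_on k S f" "open U" "bounded_linear T" "bounded_linear Q"
    and "\<And>x. x \<in> U \<Longrightarrow> a + T x \<in> S"
  shows "Ck_on k U (\<lambda>x. Q (f (a + T x)) + b)"
  using assms(1)
proof (induction k arbitrary: f b)
  case 0
  then show ?case using assms(2-)
    by (auto intro!: continuous_intros bounded_linear.continuous_on[OF assms(4)]
      bounded_linear.continuous_on[OF assms(3)] continuous_on_compose2[of S f])
next
  case (Suc k)
  have D: "((\<lambda>x. Q (f (a + T x)) + b) has_derivative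
      (\<lambda>v. Q (frechet_derivative f (at (a + T x)) (T v)))) (at x)" if "x \<in> U" for x
  proof -
    have "f differentiable at (a + T x)" using Suc.prems assms(5)[OF that] by auto
    then have f: "(f has_derivative frechet_derivative f (at (a + T x))) (at (a + T x))"
      by (simp add: frechet_derivative_works)
    have T: "((\<lambda>x. a + T x) has_derivative T) (at x)"
      using bounded_linear_imp_has_derivative[OF assms(3)] by (auto intro!: derivative_eq_intros)
    have "((\<lambda>x. f (a + T x)) has_derivative (\<lambda>v. frechet_derivative f (at (a + T x)) (T v))) (at x)"
      using has_derivative_compose[OF T f] .
    from bounded_linear.has_derivative[OF assms(4) this]
    show ?thesis by (auto intro!: derivative_eq_intros)
  qed
  have "Ck_on k U (\<lambda>x. frechet_derivative (\<lambda>x. Q (f (a + T x)) + b) (at x) v)" for v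
  proof (rule Ck_on_cong[OF assms(2)])
    show "Ck_on k U (\<lambda>x. Q (frechet_derivative f (at (a + T x)) (T v)) + 0)"
      using Suc.prems by (intro Suc.IH) auto
    show "Q (frechet_derivative f (at (a + T x)) (T v)) + 0 =
        frechet_derivative (\<lambda>x. Q (f (a + T x)) + b) (at x) v" if "x \<in> U" for x
      using frechet_derivative_at[OF D[OF that]] by (metis add_0_right)
  qed
  moreover have "(\<lambda>x. Q (f (a + T x)) + b) differentiable at x" if "x \<in> U" for x
    using D[OF that] by (auto simp: differentiable_def)
  ultimately show ?case by simp
qed

lemma Cinf_on_cong:
  assumes "open S" "\<And>x. x \<in> S \<Longrightarrow> f x = g x" "Cinf_on S f"
  shows "Cinf_on S g"
  using assms Ck_on_cong unfolding Cinf_on_def by blast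

lemma Cinf_on_const: "open S \<Longrightarrow> Cinf_on S (\<lambda>x. b)"
  by (simp add: Cinf_on_def Ck_on_const)

lemma Cinf_on_affine:
  assumes "Cinf_on S f" "open U" "bounded_linear T" "bounded_linear Q"
    and "\<And>x. x \<in> U \<Longrightarrow> a + T x \<in> S"
  shows "Cinf_on U (\<lambda>x. Q (f (a + T x)) + b)"
  using assms Ck_on_affine[of _ S f U T Q a b] unfolding Cinf_on_def by blast

lemma Cinf_on_differentiable:
  assumes "Cinf_on S f" "x \<in> S"
  shows "f differentiable at x"
  using assms unfolding Cinf_on_def by (metis Ck_on.simps(2))

lemma Cinf_on_frechet_derivative_differentiable:
  assumes "Cinf_on S f" "x \<in> S"
  shows "(\<lambda>x. frechet_derivative f (at x) v) differentiable at x"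
  using assms unfolding Cinf_on_def by (metis Ck_on.simps(2))

section \<open>Charts and smooth functions on the surface\<close>

lemma chart_open:
  assumes "riemann_surface A" "c \<in> A"
  shows "open (fst c)" and "open (snd c ` fst c)" and "inj_on (snd c) (fst c)"
    and "homeomorphism (fst c) (snd c ` fst c) (snd c) (chart_inv c)"
proof -
  show h: "homeomorphism (fst c) (snd c ` fst c) (snd c) (chart_inv c)"
    and "open (fst c)" and "open (snd c ` fst c)"
    using assms unfolding riemann_surface_def by auto
  show "inj_on (snd c) (fst c)"
    using h by (metis homeomorphism_apply1 inj_on_inverseI)
qed

lemma chart_inv_chart [simp]: "inj_on (snd c) (fst c) \<Longrightarrow> p \<in> fst c \<Longrightarrow> chart_inv c (snd c p) = p"
  by (simp add: chart_inv_def)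

lemma open_chart_image:
  assumes "riemann_surface A" "c \<in> A" "open V"
  shows "open (snd c ` (V \<inter> fst c))"
proof -
  have "openin (top_of_set (fst c)) (V \<inter> fst c)"
    using openin_open_Int[OF assms(3), of "fst c"] by (simp add: Int_commute)
  from homeomorphism_imp_open_map[OF chart_open(4)[OF assms(1,2)] this]
  show ?thesis using chart_open(2)[OF assms(1,2)] openin_open_trans by blast
qed

lemma continuous_on_chart:
  assumes "riemann_surface A" "c \<in> A"
  shows "continuous_on (fst c) (snd c)"
  using chart_open(4)[OF assms] by (simp add: homeomorphism_def)

lemma chart_exists:
  assumes "riemann_surface A"
  obtains c where "c \<in> A" "p \<in> fst c"
  using assms unfolding riemann_surface_def by blast

lemma smooth_on_const:
  assumes "riemann_surface A" "open V"
  shows "smooth_on A V (\<lambda>q. b)"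
  unfolding smooth_on_def comp_def
  by (intro ballI Cinf_on_const open_chart_image[OF assms(1) _ assms(2)])

lemma smooth_on_affine:
  assumes "riemann_surface A" "open V" "smooth_on A V f" "bounded_linear Q"
  shows "smooth_on A V (\<lambda>q. Q (f q) + b)"
  unfolding smooth_on_def
proof
  fix c assume c: "c \<in> A"
  have f: "Cinf_on (snd c ` (V \<inter> fst c)) (f \<circ> chart_inv c)"
    using assms(3) c unfolding smooth_on_def by blast
  have "Cinf_on (snd c ` (V \<inter> fst c)) (\<lambda>x. Q ((f \<circ> chart_inv c) (0 + x)) + b)"
    by (rule Cinf_on_affine[where T = "\<lambda>x. x", OF f open_chart_image[OF assms(1) c assms(2)] bounded_linear_ident
      assms(4)]) simp
  then show "Cinf_on (snd c ` (V \<inter> fst c)) ((\<lambda>q. Q (f q) + b) \<circ> chart_inv c)"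
    unfolding comp_def add_0_left .
qed

lemma smooth_on_differentiable:
  assumes "smooth_on A V f" "c \<in> A" "p \<in> V" "p \<in> fst c"
  shows "(f \<circ> chart_inv c) differentiable at (snd c p)"
  using assms by (auto simp: smooth_on_def intro!: Cinf_on_differentiable)

lemma smooth_on_has_derivative:
  assumes "smooth_on A V f" "c \<in> A" "p \<in> V" "p \<in> fst c"
  obtains F' where "((f \<circ> chart_inv c) has_derivative F') (at (snd c p))"
  using smooth_on_differentiable[OF assms] by (auto simp: differentiable_def)

lemma smooth_on_continuous:
  assumes "riemann_surface A" "smooth_on A UNIV f"
  shows "continuous_on UNIV f"
proof (rule continuous_at_imp_continuous_on, intro ballI)
  fix p
  obtain c where c: "c \<in> A" "p \<in> fst c" using chart_exists[OF assms(1)] .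
  have "continuous_on (snd c ` fst c) (f \<circ> chart_inv c)"
    using assms(2) c unfolding smooth_on_def Cinf_on_def by (metis Ck_on.simps(1) Int_UNIV_left)
  then have "continuous_on (fst c) (\<lambda>q. (f \<circ> chart_inv c) (snd c q))"
    by (intro continuous_on_compose2[OF _ continuous_on_chart[OF assms(1) c(1)]]) auto
  then have "continuous_on (fst c) f"
    by (rule continuous_on_eq) (use chart_open(3)[OF assms(1) c(1)] in simp)
  then show "isCont f p"
    using c(2) continuous_on_eq_continuous_at[OF chart_open(1)[OF assms(1) c(1)]] by blast
qed

section \<open>Wirtinger derivatives and the bilinear operations on matrices\<close>

lemma wirtinger_eq:
  assumes "((f \<circ> chart_inv c) has_derivative F') (at (snd c p))"
  shows "wirtinger c f p = (1/2) *s (F' 1 - \<i> *s F' \<i>)"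
    and "wirtinger_bar c f p = (1/2) *s (F' 1 + \<i> *s F' \<i>)"
  using frechet_derivative_at[OF assms] by (simp_all add: wirtinger_def wirtinger_bar_def Let_def)

lemmas mat2_simps = vec_eq_iff forall_2 sum_2 UNIV_2 matrix_vector_mult_def matrix_matrix_mult_def
  vector_scalar_mult_def cscale_def conj_mat_def transpose_def mat_def trace_def

text \<open>In finite dimension bilinear maps are bounded; this one supplies the product rule for a
  matrix applied to a section.\<close>

lemma bilinear_mv: "bounded_bilinear ((*v) :: cmat \<Rightarrow> complex^2 \<Rightarrow> complex^2)"
  unfolding bilinear_conv_bounded_bilinear[symmetric] bilinear_def
  by (intro conjI allI linearI, simp_all only: mat2_simps vector_add_component
      vector_scaleR_component vec_lambda_beta nth_map_matrix)
    (simp_all add: distrib_left distrib_right scaleR_right_distrib)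

lemma bilinear_mm: "bounded_bilinear ((**) :: cmat \<Rightarrow> cmat \<Rightarrow> cmat)"
  unfolding bilinear_conv_bounded_bilinear[symmetric] bilinear_def
  by (intro conjI allI linearI, simp_all only: mat2_simps vector_add_component
      vector_scaleR_component vec_lambda_beta nth_map_matrix)
    (simp_all add: distrib_left distrib_right scaleR_right_distrib)

lemma bilinear_cscale: "bounded_bilinear cscale"
  unfolding bilinear_conv_bounded_bilinear[symmetric] bilinear_def
  by (intro conjI allI linearI, simp_all only: mat2_simps vector_add_component
      vector_scaleR_component vec_lambda_beta nth_map_matrix)
    (simp_all add: distrib_left distrib_right scaleR_right_distrib)

lemma bilinear_smult: "bounded_bilinear ((*s) :: complex \<Rightarrow> complex^2 \<Rightarrow> complex^2)"
  unfolding bilinear_conv_bounded_bilinear[symmetric] bilinear_def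
  by (intro conjI allI linearI, simp_all only: mat2_simps vector_add_component
      vector_scaleR_component vec_lambda_beta nth_map_matrix)
    (simp_all add: distrib_left distrib_right scaleR_right_distrib)

section \<open>The quaternionic structure and the conjugate surface\<close>

lemma matrix_inv_SL2:
  assumes "g \<in> SL2"
  shows "g ** matrix_inv g = mat 1" and "matrix_inv g ** g = mat 1"
proof -
  have "invertible g" using assms by (simp add: SL2_def invertible_det_nz)
  then have "g ** matrix_inv g = mat 1 \<and> matrix_inv g ** g = mat 1"
    unfolding invertible_def matrix_inv_def by (rule someI_ex)
  then show "g ** matrix_inv g = mat 1" and "matrix_inv g ** g = mat 1" by auto
qed

text \<open>Turns the gauge law into the form without \<open>matrix_inv\<close>, in which
  \<open>g\<close> times the new operator equals the old operator applied to \<open>g\<close> times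
  the section.\<close>

lemma matrix_inv_SL2_eq_iff:
  assumes "g \<in> SL2"
  shows "v = matrix_inv g *v w \<longleftrightarrow> g *v v = w"
  using matrix_inv_SL2[OF assms] by (metis matrix_vector_mul_assoc matrix_vector_mul_lid)

definition quat_unit :: cmat where
  "quat_unit = vector [vector [0, 1], vector [-1, 0]]"

text \<open>The quaternionic structure of the plane: antilinear with square -1, equal to
  \<open>- quat_unit\<close> applied to the conjugate vector.\<close>

definition quat_vec :: "complex^2 \<Rightarrow> complex^2" where
  "quat_vec v = vector [- cnj (v $ 2), cnj (v $ 1)]"

text \<open>Conjugation by the quaternionic structure, that is, \<open>quat_unit\<close> times the
  conjugate of \<open>M\<close> times the inverse of \<open>quat_unit\<close>. It is also the
  adjoint of the classical adjugate of \<open>M\<close>.\<close>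

definition quat_mat :: "cmat \<Rightarrow> cmat" where
  "quat_mat M = vector [vector [cnj (M $ 2 $ 2), - cnj (M $ 2 $ 1)],
                        vector [- cnj (M $ 1 $ 2), cnj (M $ 1 $ 1)]]"

lemma quat_vec_mult: "quat_vec (M *v v) = quat_mat M *v quat_vec v"
  by (simp add: quat_vec_def quat_mat_def mat2_simps algebra_simps)

lemma quat_vec_quat_vec [simp]: "quat_vec (quat_vec v) = - v"
  by (simp add: quat_vec_def mat2_simps)

lemma quat_mat_quat_mat [simp]: "quat_mat (quat_mat M) = M"
  by (simp add: quat_mat_def mat2_simps)

lemma bounded_linear_quat_vec: "bounded_linear quat_vec"
  unfolding linear_conv_bounded_linear[symmetric]
  by (intro linearI) (simp_all add: quat_vec_def mat2_simps)

lemma bounded_linear_quat_mat: "bounded_linear quat_mat"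
  unfolding linear_conv_bounded_linear[symmetric]
  by (intro linearI) (simp_all add: quat_mat_def mat2_simps)

lemmas linear_quat_vec = bounded_linear.linear[OF bounded_linear_quat_vec]

lemma quat_mat_SL2: "g \<in> SL2 \<Longrightarrow> quat_mat g \<in> SL2"
proof -
  have "det (quat_mat g) = cnj (det g)"
    by (simp add: det_2 quat_mat_def mult.commute)
  then show "g \<in> SL2 \<Longrightarrow> quat_mat g \<in> SL2" by (simp add: SL2_def)
qed

text \<open>The adjugate of a trace-free matrix of size two is its negative.\<close>

lemma quat_mat_trace_free: "trace M = 0 \<Longrightarrow> quat_mat M = - adj_mat M"
  by (simp add: quat_mat_def adj_mat_def mat2_simps add_eq_0_iff)

section \<open>Charts, smoothness and Wirtinger derivatives on the conjugate surface\<close>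

lemma conj_chart_conj_chart [simp]: "conj_chart (conj_chart c) = c"
  by (simp add: conj_chart_def prod_eq_iff fun_eq_iff)

lemma fst_conj_chart [simp]: "fst (conj_chart c) = fst c"
  and snd_conj_chart [simp]: "snd (conj_chart c) p = cnj (snd c p)"
  by (simp_all add: conj_chart_def)

lemma conj_chart_image: "snd (conj_chart c) ` W = cnj ` (snd c ` W)"
  by (auto simp: conj_chart_def image_comp)

lemma conj_atlas_iff [simp]: "c \<in> conj_atlas A \<longleftrightarrow> conj_chart c \<in> A"
  by (metis conj_atlas_def conj_chart_conj_chart image_iff)

lemma open_cnj_image:
  assumes "open S"
  shows "open (cnj ` S)"
proof -
  have "cnj ` S = cnj -` S" by (auto simp: image_iff) (metis complex_cnj_cnj)
  then show ?thesis using assms by (simp add: open_vimage continuous_on_cnj continuous_on_id)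
qed

lemma inj_on_conj_chart: "inj_on (snd c) (fst c) \<Longrightarrow> inj_on (snd (conj_chart c)) (fst c)"
  by (auto simp: inj_on_def)

text \<open>The two inverses are compared only on the image of the chart, since
  \<open>inv_into\<close> carries no information outside it.\<close>

lemma chart_inv_conj_chart:
  assumes "inj_on (snd c) (fst c)" "z \<in> snd c ` fst c"
  shows "chart_inv (conj_chart c) (cnj z) = chart_inv c z"
proof -
  obtain p where p: "p \<in> fst c" "z = snd c p" using assms(2) by auto
  have "chart_inv (conj_chart c) (snd (conj_chart c) p) = p"
    using inj_on_conj_chart[OF assms(1)] p by (intro chart_inv_chart) auto
  then show ?thesis using p assms(1) by simp
qed

lemma Cinf_on_conj_chart:
  assumes "inj_on (snd c) (fst c)" "W \<subseteq> fst c" "open (snd c ` W)"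
    and "Cinf_on (snd c ` W) (f \<circ> chart_inv c)"
  shows "Cinf_on (snd (conj_chart c) ` W) (f \<circ> chart_inv (conj_chart c))"
proof -
  have o: "open (snd (conj_chart c) ` W)"
    unfolding conj_chart_image by (rule open_cnj_image[OF assms(3)])
  show ?thesis
  proof (rule Cinf_on_cong[OF o])
    show "Cinf_on (snd (conj_chart c) ` W) (\<lambda>x. (f \<circ> chart_inv c) (0 + cnj x) + 0)"
      by (rule Cinf_on_affine[OF assms(4) o bounded_linear_cnj bounded_linear_ident]) auto
    show "(f \<circ> chart_inv c) (0 + cnj x) + 0 = (f \<circ> chart_inv (conj_chart c)) x"
      if x: "x \<in> snd (conj_chart c) ` W" for x
    proof -
      have "cnj x \<in> snd c ` fst c" using x assms(2) by auto
      then show ?thesis using chart_inv_conj_chart[OF assms(1), of "cnj x"] by simp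
    qed
  qed
qed

text \<open>Complex conjugation of the coordinate is real linear, so it preserves real smoothness,
  and as an involution it gives both directions.\<close>

lemma smooth_on_conj_atlas:
  assumes "riemann_surface A" "open V"
  shows "smooth_on (conj_atlas A) V f \<longleftrightarrow> smooth_on A V f"
proof -
  have "Cinf_on (snd (conj_chart c) ` (V \<inter> fst c)) (f \<circ> chart_inv (conj_chart c)) \<longleftrightarrow>
      Cinf_on (snd c ` (V \<inter> fst c)) (f \<circ> chart_inv c)" if c: "c \<in> A" for c
  proof
    note o = open_chart_image[OF assms(1) c assms(2)] and inj = chart_open(3)[OF assms(1) c]
    show "Cinf_on (snd (conj_chart c) ` (V \<inter> fst c)) (f \<circ> chart_inv (conj_chart c))"
      if "Cinf_on (snd c ` (V \<inter> fst c)) (f \<circ> chart_inv c)"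
      using Cinf_on_conj_chart[OF inj _ o that] by simp
    have o': "open (snd (conj_chart c) ` (V \<inter> fst c))"
      unfolding conj_chart_image by (rule open_cnj_image[OF o])
    show "Cinf_on (snd c ` (V \<inter> fst c)) (f \<circ> chart_inv c)"
      if "Cinf_on (snd (conj_chart c) ` (V \<inter> fst c)) (f \<circ> chart_inv (conj_chart c))"
      using Cinf_on_conj_chart[of "conj_chart c", OF _ _ o' that] inj_on_conj_chart[OF inj] by simp
  qed
  then show ?thesis unfolding smooth_on_def conj_atlas_def by simp
qed

lemma has_derivative_conj_chart:
  assumes "riemann_surface A" "c \<in> A" "p \<in> fst c"
    and "((f \<circ> chart_inv c) has_derivative F') (at (snd c p))"
  shows "((f \<circ> chart_inv (conj_chart c)) has_derivative (F' \<circ> cnj)) (at (snd (conj_chart c) p))"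
proof -
  have "(((f \<circ> chart_inv c) \<circ> cnj) has_derivative (F' \<circ> cnj)) (at (snd (conj_chart c) p))"
    using assms(4) by (intro diff_chain_at bounded_linear_imp_has_derivative bounded_linear_cnj) simp
  then show ?thesis
  proof (rule has_derivative_transform_within_open[where s = "cnj ` snd c ` fst c"])
    show "open (cnj ` snd c ` fst c)"
      using chart_open(2)[OF assms(1,2)] by (rule open_cnj_image)
    show "snd (conj_chart c) p \<in> cnj ` snd c ` fst c" using assms(3) by auto
    show "((f \<circ> chart_inv c) \<circ> cnj) x = (f \<circ> chart_inv (conj_chart c)) x"
      if "x \<in> cnj ` snd c ` fst c" for x
      using that chart_inv_conj_chart[OF chart_open(3)[OF assms(1,2)]] by auto
  qed
qed

text \<open>Conjugating the coordinate reverses the sign of the derivative in direction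
  \<open>\<i>\<close>, which exchanges the two Wirtinger operators.\<close>

lemma wirtinger_conj_chart:
  assumes "riemann_surface A" "c \<in> A" "p \<in> fst c"
    and "(f \<circ> chart_inv c) differentiable (at (snd c p))"
  shows "wirtinger (conj_chart c) f p = wirtinger_bar c f p"
    and "wirtinger_bar (conj_chart c) f p = wirtinger c f p"
proof -
  obtain F' where F': "((f \<circ> chart_inv c) has_derivative F') (at (snd c p))"
    using assms(4) by (auto simp: differentiable_def)
  note W = wirtinger_eq[OF has_derivative_conj_chart[OF assms(1-3) F']] wirtinger_eq[OF F']
  have "F' (cnj \<i>) = - F' \<i>"
    using linear_neg[OF has_derivative_linear[OF F']] by simp
  moreover have "\<i> *s (- w) = - (\<i> *s w)" for w :: "complex^2"
    by (simp add: mat2_simps)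
  ultimately show "wirtinger (conj_chart c) f p = wirtinger_bar c f p"
    and "wirtinger_bar (conj_chart c) f p = wirtinger c f p"
    unfolding W by (simp_all only: comp_def complex_cnj_one diff_minus_eq_add add_uminus_conv_diff)
qed

text \<open>An antilinear map of the values turns multiplication by \<open>\<i>\<close> into
  multiplication by \<open>-\<i>\<close>, which again exchanges the two operators.\<close>

lemma wirtinger_quat_vec:
  assumes "(f \<circ> chart_inv c) differentiable (at (snd c p))"
  shows "wirtinger c (\<lambda>q. quat_vec (f q)) p = quat_vec (wirtinger_bar c f p)"
    and "wirtinger_bar c (\<lambda>q. quat_vec (f q)) p = quat_vec (wirtinger c f p)"
proof -
  obtain F' where F': "((f \<circ> chart_inv c) has_derivative F') (at (snd c p))"
    using assms by (auto simp: differentiable_def)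
  have "(((\<lambda>q. quat_vec (f q)) \<circ> chart_inv c) has_derivative (\<lambda>h. quat_vec (F' h))) (at (snd c p))"
    using bounded_linear.has_derivative[OF bounded_linear_quat_vec F'] by (simp add: comp_def)
  note W = wirtinger_eq[OF this] wirtinger_eq[OF F']
  show "wirtinger c (\<lambda>q. quat_vec (f q)) p = quat_vec (wirtinger_bar c f p)"
    and "wirtinger_bar c (\<lambda>q. quat_vec (f q)) p = quat_vec (wirtinger c f p)"
    unfolding W by (simp_all add: quat_vec_def mat2_simps field_simps)
qed

lemma differentiable_quat_vec:
  assumes "(f \<circ> chart_inv c) differentiable (at x)"
  shows "((\<lambda>q. quat_vec (f q)) \<circ> chart_inv c) differentiable (at x)"
proof -
  obtain F' where "((f \<circ> chart_inv c) has_derivative F') (at x)"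
    using assms by (auto simp: differentiable_def)
  from bounded_linear.has_derivative[OF bounded_linear_quat_vec this] show ?thesis
    by (auto simp: differentiable_def comp_def)
qed

text \<open>The exchange from the conjugate chart and the one from antilinearity cancel, so
  Dolbeault operators go to Dolbeault operators of the conjugate surface.\<close>

lemma dbar_op_quat_vec:
  assumes "riemann_surface A" "c \<in> A" "p \<in> fst c"
    and "(f \<circ> chart_inv c) differentiable (at (snd c p))"
    and "\<alpha>' (conj_chart c) p = quat_mat (\<alpha> c p)"
  shows "dbar_op \<alpha>' (conj_chart c) (\<lambda>q. quat_vec (f q)) p = quat_vec (dbar_op \<alpha> c f p)"
  using wirtinger_conj_chart(2)[OF assms(1-3) differentiable_quat_vec[OF assms(4)]]
    wirtinger_quat_vec(1)[OF assms(4)] assms(5)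
  by (simp add: dbar_op_def quat_vec_mult linear_add[OF linear_quat_vec])

text \<open>The exchanges cancel as before, but the parameter is conjugated. With the sign chosen
  for \<open>\<beta>'\<close> it becomes \<open>- cnj l\<close>, which is the antipode of
  \<open>l\<close> in the coordinate around infinity.\<close>

lemma D_op_quat_vec:
  assumes "riemann_surface A" "c \<in> A" "p \<in> fst c"
    and "(f \<circ> chart_inv c) differentiable (at (snd c p))"
    and "\<beta>' (conj_chart c) p = - quat_mat (\<beta> c p)"
  shows "D_op (- cnj l) \<beta>' (conj_chart c) (\<lambda>q. quat_vec (f q)) p = - quat_vec (D_op l \<beta> c f p)"
proof -
  have "- cnj l *s quat_vec w + (- quat_mat M) *v quat_vec v = - (quat_vec (l *s w + M *v v))" for w v M
    by (simp add: quat_vec_def quat_mat_def mat2_simps algebra_simps)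
  then show ?thesis
    using wirtinger_conj_chart(1)[OF assms(1-3) differentiable_quat_vec[OF assms(4)]]
      wirtinger_quat_vec(2)[OF assms(4)] assms(5) by (simp add: D_op_def)
qed

lemma smooth_on_cong:
  assumes "riemann_surface A" "open V" "smooth_on A V f" "\<And>q. q \<in> V \<Longrightarrow> f q = g q"
  shows "smooth_on A V g"
  unfolding smooth_on_def
proof
  fix c assume c: "c \<in> A"
  show "Cinf_on (snd c ` (V \<inter> fst c)) (g \<circ> chart_inv c)"
  proof (rule Cinf_on_cong[OF open_chart_image[OF assms(1) c assms(2)]])
    show "Cinf_on (snd c ` (V \<inter> fst c)) (f \<circ> chart_inv c)"
      using assms(3) c unfolding smooth_on_def by blast
    show "(f \<circ> chart_inv c) x = (g \<circ> chart_inv c) x" if "x \<in> snd c ` (V \<inter> fst c)" for x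
      using that assms(4) chart_open(3)[OF assms(1) c] by auto
  qed
qed

lemma differentiable_mv:
  fixes M :: "'a \<Rightarrow> cmat"
  assumes "(M \<circ> k) differentiable (at x)" "(f \<circ> k) differentiable (at x)"
  shows "((\<lambda>q. M q *v f q) \<circ> k) differentiable (at x)"
proof -
  obtain M' f' where "((M \<circ> k) has_derivative M') (at x)" "((f \<circ> k) has_derivative f') (at x)"
    using assms by (auto simp: differentiable_def)
  from bounded_bilinear.FDERIV[OF bilinear_mv this] show ?thesis
    by (auto simp: differentiable_def comp_def)
qed

text \<open>The commutation condition of a connection applies one operator to the result of another,
  so a section must stay differentiable after one operator. The coefficients \<open>a\<close>,
  \<open>b\<close> treat both operators at once.\<close>

lemma differentiable_op:
  fixes a b :: complex
  assumes "riemann_surface A" "c \<in> A" "p \<in> fst c" "smooth_on A (fst c) (\<gamma> c)" "smooth_on A UNIV \<sigma>"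
  shows "((\<lambda>q. a *s wirtinger c \<sigma> q + b *s wirtinger_bar c \<sigma> q + \<gamma> c q *v \<sigma> q) \<circ> chart_inv c)
    differentiable (at (snd c p))"
proof -
  define f where "f = \<sigma> \<circ> chart_inv c"
  let ?S = "snd c ` fst c"
  have o: "open ?S" and p: "snd c p \<in> ?S" using chart_open(2)[OF assms(1,2)] assms(3) by auto
  have f: "Cinf_on ?S f" using assms(2,5) by (simp add: smooth_on_def f_def)
  have \<gamma>: "(\<gamma> c \<circ> chart_inv c) differentiable (at (snd c p))"
    using smooth_on_differentiable[OF assms(4,2,3,3)] .
  have \<sigma>: "(\<sigma> \<circ> chart_inv c) differentiable (at (snd c p))"
    using smooth_on_differentiable[OF assms(5,2) UNIV_I assms(3)] .
  have P: "(\<lambda>x. (\<gamma> c (chart_inv c x)) *v (\<sigma> (chart_inv c x))) differentiable (at (snd c p))"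
    using differentiable_mv[OF \<gamma> \<sigma>] by (simp add: comp_def)
  note D = Cinf_on_frechet_derivative_differentiable[OF f p]
  have lin: "(\<lambda>x. k *s u x) differentiable (at y)" if "u differentiable (at y)"
    for k and u :: "complex \<Rightarrow> complex^2" and y
    using bounded_linear.has_derivative[OF bounded_bilinear.bounded_linear_right[OF bilinear_smult]] that
    unfolding differentiable_def by blast
  let ?E = "\<lambda>x. a *s ((1/2) *s (frechet_derivative f (at x) 1 - \<i> *s frechet_derivative f (at x) \<i>))
    + b *s ((1/2) *s (frechet_derivative f (at x) 1 + \<i> *s frechet_derivative f (at x) \<i>))
    + (\<gamma> c (chart_inv c x)) *v (\<sigma> (chart_inv c x))"
  have "?E differentiable (at (snd c p))"
    by (intro differentiable_add differentiable_diff lin D P)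
  then obtain E' where "(?E has_derivative E') (at (snd c p))" by (auto simp: differentiable_def)
  then have "((\<lambda>q. a *s wirtinger c \<sigma> q + b *s wirtinger_bar c \<sigma> q + \<gamma> c q *v \<sigma> q) \<circ> chart_inv c
      has_derivative E') (at (snd c p))"
  proof (rule has_derivative_transform_within_open[OF _ o p])
    show "?E x = ((\<lambda>q. a *s wirtinger c \<sigma> q + b *s wirtinger_bar c \<sigma> q + \<gamma> c q *v \<sigma> q) \<circ> chart_inv c) x"
      if "x \<in> ?S" for x
    proof -
      have "snd c (chart_inv c x) = x" using that chart_open(3)[OF assms(1,2)] by auto
      then show ?thesis by (simp add: wirtinger_def wirtinger_bar_def Let_def f_def)
    qed
  qed
  then show ?thesis by (auto simp: differentiable_def)
qed

lemma differentiable_dbar_op: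
  assumes "riemann_surface A" "c \<in> A" "p \<in> fst c" "form01 A \<alpha>" "smooth_on A UNIV \<sigma>"
  shows "(dbar_op \<alpha> c \<sigma> \<circ> chart_inv c) differentiable (at (snd c p))"
proof -
  have "dbar_op \<alpha> c \<sigma> = (\<lambda>q. 0 *s wirtinger c \<sigma> q + 1 *s wirtinger_bar c \<sigma> q + \<alpha> c q *v \<sigma> q)"
    by (simp add: fun_eq_iff dbar_op_def)
  then show ?thesis
    using differentiable_op[OF assms(1-3) _ assms(5), of \<alpha> 0 1] assms(2,4) by (simp add: form01_def)
qed

lemma differentiable_D_op:
  assumes "riemann_surface A" "c \<in> A" "p \<in> fst c" "form10 A \<beta>" "smooth_on A UNIV \<sigma>"
  shows "(D_op l \<beta> c \<sigma> \<circ> chart_inv c) differentiable (at (snd c p))"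
proof -
  have "D_op l \<beta> c \<sigma> = (\<lambda>q. l *s wirtinger c \<sigma> q + 0 *s wirtinger_bar c \<sigma> q + \<beta> c q *v \<sigma> q)"
    by (simp add: fun_eq_iff D_op_def)
  then show ?thesis
    using differentiable_op[OF assms(1-3) _ assms(5), of \<beta> l 0] assms(2,4) by (simp add: form10_def)
qed

text \<open>Formulas for the inner of two nested operators hold only on the domain of a chart; this
  allows rewriting with them under the outer one.\<close>

lemma wirtinger_cong:
  assumes "inj_on (snd c) (fst c)" "open (snd c ` fst c)" "p \<in> fst c" "\<And>q. q \<in> fst c \<Longrightarrow> f q = g q"
    and "(f \<circ> chart_inv c) differentiable (at (snd c p))"
  shows "wirtinger c f p = wirtinger c g p" and "wirtinger_bar c f p = wirtinger_bar c g p"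
proof -
  have "frechet_derivative (f \<circ> chart_inv c) (at (snd c p)) =
      frechet_derivative (g \<circ> chart_inv c) (at (snd c p))"
    by (rule frechet_derivative_transform_within_open[OF assms(5,2)])
      (use assms(1,3,4) in auto)
  then show "wirtinger c f p = wirtinger c g p" and "wirtinger_bar c f p = wirtinger_bar c g p"
    by (simp_all add: wirtinger_def wirtinger_bar_def)
qed

text \<open>An \<open>l\<close>-connection corresponds to a \<open>(- cnj l)\<close>-connection on the conjugate surface, and the sign of the
  parameter forces the sign of the second component.\<close>

definition quat_conj :: "'a::t2_space chart set \<Rightarrow> 'a conn \<Rightarrow> 'a conn \<Rightarrow> bool" where
  "quat_conj A C C' \<longleftrightarrow> (\<forall>c\<in>A. \<forall>p\<in>fst c.
     fst C' (conj_chart c) p = quat_mat (fst C c p) \<and>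
     snd C' (conj_chart c) p = - quat_mat (snd C c p))"

section \<open>Forms, connections and gauge equivalences on the conjugate surface\<close>

text \<open>In conjugate charts a transition map \<open>f\<close> becomes
  \<open>cnj \<circ> f \<circ> cnj\<close>, whose derivative is the conjugate one.\<close>

lemma deriv_transition_conj_chart:
  assumes "riemann_surface A" "c \<in> A" "c' \<in> A" "p \<in> fst c \<inter> fst c'"
  shows "deriv (snd (conj_chart c') \<circ> chart_inv (conj_chart c)) (snd (conj_chart c) p) =
    cnj (deriv (snd c' \<circ> chart_inv c) (snd c p))"
proof -
  let ?S = "snd c ` (fst c \<inter> fst c')"
  have o: "open ?S" using open_chart_image[OF assms(1,2) chart_open(1)[OF assms(1,3)]]
    by (simp add: Int_commute)
  have "(snd c' \<circ> chart_inv c) holomorphic_on ?S"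
    using assms(1-3) unfolding riemann_surface_def by blast
  then have "((snd c' \<circ> chart_inv c) has_field_derivative deriv (snd c' \<circ> chart_inv c) (snd c p))
      (at (snd c p))"
    using o assms(4) by (intro holomorphic_derivI) auto
  then have "((cnj \<circ> (snd c' \<circ> chart_inv c) \<circ> cnj) has_field_derivative
      cnj (deriv (snd c' \<circ> chart_inv c) (snd c p))) (at (snd (conj_chart c) p))"
    by (intro has_field_derivative_cnj_cnj) simp
  then have "((snd (conj_chart c') \<circ> chart_inv (conj_chart c)) has_field_derivative
      cnj (deriv (snd c' \<circ> chart_inv c) (snd c p))) (at (snd (conj_chart c) p))"
  proof (rule has_field_derivative_transform_within_open[OF _ open_cnj_image[OF o]])
    show "snd (conj_chart c) p \<in> cnj ` ?S" using assms(4) by auto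
    show "(cnj \<circ> (snd c' \<circ> chart_inv c) \<circ> cnj) x = (snd (conj_chart c') \<circ> chart_inv (conj_chart c)) x"
      if "x \<in> cnj ` ?S" for x
      using that chart_inv_conj_chart[OF chart_open(3)[OF assms(1,2)]] by auto
  qed
  then show ?thesis by (rule DERIV_imp_deriv)
qed

context
  fixes A :: "'a::t2_space chart set" and Q :: "cmat \<Rightarrow> cmat"
  assumes A: "riemann_surface A"
    and Q: "bounded_linear Q" "\<And>k M. Q (cscale k M) = cscale (cnj k) (Q M)"
begin

lemma smooth_on_conj_form:
  assumes "\<forall>c\<in>A. smooth_on A (fst c) (\<gamma> c)"
    and "\<And>c p. c \<in> A \<Longrightarrow> p \<in> fst c \<Longrightarrow> \<gamma>' (conj_chart c) p = Q (\<gamma> c p)"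
  shows "\<forall>c\<in>conj_atlas A. smooth_on (conj_atlas A) (fst c) (\<gamma>' c)"
proof
  fix c' assume c: "c' \<in> conj_atlas A"
  define c where "c = conj_chart c'"
  have c': "c \<in> A" "c' = conj_chart c" using c by (auto simp: c_def)
  note o = chart_open(1)[OF A c'(1)]
  have "smooth_on A (fst c) (\<lambda>q. Q (\<gamma> c q) + 0)"
    using assms(1) c'(1) by (intro smooth_on_affine[OF A o _ Q(1)]) auto
  then have "smooth_on A (fst c) (\<gamma>' c')"
    by (rule smooth_on_cong[OF A o]) (use assms(2) c' in simp)
  then show "smooth_on (conj_atlas A) (fst c') (\<gamma>' c')"
    by (simp add: c'(2) smooth_on_conj_atlas[OF A o])
qed

text \<open>The antilinear \<open>Q\<close> conjugates the transition factor, and so does passing to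
  conjugate charts, so the type is kept. The map \<open>Q\<close> will be \<open>quat_mat\<close> or
  its negative.\<close>

lemma form01_conj:
  assumes "form01 A \<gamma>" "\<And>c p. c \<in> A \<Longrightarrow> p \<in> fst c \<Longrightarrow> \<gamma>' (conj_chart c) p = Q (\<gamma> c p)"
  shows "form01 (conj_atlas A) \<gamma>'"
  unfolding form01_def
proof (intro conjI ballI)
  show "smooth_on (conj_atlas A) (fst c) (\<gamma>' c)" if "c \<in> conj_atlas A" for c
    using that smooth_on_conj_form[of \<gamma> \<gamma>', OF _ assms(2)] assms(1) unfolding form01_def by blast
  fix d d' p assume d: "d \<in> conj_atlas A" "d' \<in> conj_atlas A" "p \<in> fst d \<inter> fst d'"
  define c c' where "c = conj_chart d" "c' = conj_chart d'"
  have c: "c \<in> A" "c' \<in> A" "d = conj_chart c" "d' = conj_chart c'" "p \<in> fst c \<inter> fst c'"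
    using d by (auto simp: c_c'_def)
  have "\<gamma> c p = cscale (cnj (deriv (snd c' \<circ> chart_inv c) (snd c p))) (\<gamma> c' p)"
    using assms(1) c unfolding form01_def by blast
  moreover have "\<gamma>' (conj_chart c) p = Q (\<gamma> c p)" "\<gamma>' (conj_chart c') p = Q (\<gamma> c' p)"
    using assms(2) c by blast+
  ultimately show "\<gamma>' d p = cscale (cnj (deriv (snd d' \<circ> chart_inv d) (snd d p))) (\<gamma>' d' p)"
    unfolding c(3,4) deriv_transition_conj_chart[OF A c(1,2,5)] by (metis Q(2) complex_cnj_cnj)
qed

lemma form10_conj:
  assumes "form10 A \<gamma>" "\<And>c p. c \<in> A \<Longrightarrow> p \<in> fst c \<Longrightarrow> \<gamma>' (conj_chart c) p = Q (\<gamma> c p)"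
  shows "form10 (conj_atlas A) \<gamma>'"
  unfolding form10_def
proof (intro conjI ballI)
  show "smooth_on (conj_atlas A) (fst c) (\<gamma>' c)" if "c \<in> conj_atlas A" for c
    using that smooth_on_conj_form[of \<gamma> \<gamma>', OF _ assms(2)] assms(1) unfolding form10_def by blast
  fix d d' p assume d: "d \<in> conj_atlas A" "d' \<in> conj_atlas A" "p \<in> fst d \<inter> fst d'"
  define c c' where "c = conj_chart d" "c' = conj_chart d'"
  have c: "c \<in> A" "c' \<in> A" "d = conj_chart c" "d' = conj_chart c'" "p \<in> fst c \<inter> fst c'"
    using d by (auto simp: c_c'_def)
  have "\<gamma> c p = cscale (deriv (snd c' \<circ> chart_inv c) (snd c p)) (\<gamma> c' p)"
    using assms(1) c unfolding form10_def by blast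
  moreover have "\<gamma>' (conj_chart c) p = Q (\<gamma> c p)" "\<gamma>' (conj_chart c') p = Q (\<gamma> c' p)"
    using assms(2) c by blast+
  ultimately show "\<gamma>' d p = cscale (deriv (snd d' \<circ> chart_inv d) (snd d p)) (\<gamma>' d' p)"
    unfolding c(3,4) deriv_transition_conj_chart[OF A c(1,2,5)] by (metis Q(2) complex_cnj_cnj)
qed

text \<open>Joint smoothness survives the real linear substitution of
  \<open>(- cnj l, cnj z)\<close> for \<open>(l, z)\<close>. Holomorphy in the parameter is assumed,
  as it can be read off the explicit family to which this is applied.\<close>

lemma holomorphic_form_family_conj:
  fixes \<Gamma> \<Gamma>' :: "complex \<Rightarrow> 'a mform"
  assumes "holomorphic_form_family A UNIV \<Gamma>"
    and "\<And>m c p. c \<in> A \<Longrightarrow> p \<in> fst c \<Longrightarrow> \<Gamma>' m (conj_chart c) p = Q (\<Gamma> (- cnj m) c p)"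
    and "\<And>c p i j. (\<lambda>m. \<Gamma>' m c p $ i $ j) holomorphic_on UNIV"
  shows "holomorphic_form_family (conj_atlas A) UNIV \<Gamma>'"
  unfolding holomorphic_form_family_def
proof (intro ballI conjI allI assms(3))
  fix c' assume c: "c' \<in> conj_atlas A"
  define c where "c = conj_chart c'"
  have c': "c \<in> A" "c' = conj_chart c" using c by (auto simp: c_def)
  let ?S = "UNIV \<times> (snd c ` fst c)" and ?U = "UNIV \<times> (snd c' ` fst c') :: (complex \<times> complex) set"
  let ?f = "\<lambda>(l, z). \<Gamma> l c (chart_inv c z)" and ?T = "\<lambda>(l, z). (- cnj l, cnj z)"
  have f: "Cinf_on ?S ?f" using assms(1) c'(1) by (auto simp: holomorphic_form_family_def)
  have o: "open ?U"
    using open_cnj_image[OF chart_open(2)[OF A c'(1)]] conj_chart_image[of c "fst c"]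
    by (simp add: open_Times c'(2))
  have T: "bounded_linear ?T"
    unfolding linear_conv_bounded_linear[symmetric] by (auto intro!: linearI)
  have "Cinf_on ?U (\<lambda>x. Q (?f (0 + ?T x)) + 0)"
    by (rule Cinf_on_affine[OF f o T Q(1)]) (auto simp: c'(2))
  then show "Cinf_on ?U (\<lambda>(l, z). \<Gamma>' l c' (chart_inv c' z))"
  proof (rule Cinf_on_cong[OF o, rotated])
    fix x assume "x \<in> ?U"
    then obtain l p where x: "x = (l, snd c' p)" "p \<in> fst c" using c'(2) by auto
    have "chart_inv c' (snd c' p) = p"
      using inj_on_conj_chart[OF chart_open(3)[OF A c'(1)]] x(2) by (intro chart_inv_chart) (auto simp: c'(2))
    moreover have "chart_inv c (cnj (snd c' p)) = p"
      using chart_open(3)[OF A c'(1)] x(2) by (simp add: c'(2))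
    ultimately show "Q (?f (0 + ?T x)) + 0 = (case x of (l, z) \<Rightarrow> \<Gamma>' l c' (chart_inv c' z))"
      using assms(2)[OF c'(1) x(2), of l] by (simp add: x(1) c'(2))
  qed
qed

end

lemma quat_mat_cscale: "quat_mat (cscale k M) = cscale (cnj k) (quat_mat M)"
  by (simp add: quat_mat_def mat2_simps)

lemmas quat_mat_semilinear = bounded_linear_quat_mat quat_mat_cscale

lemma minus_quat_mat_semilinear:
  "bounded_linear (\<lambda>M. - quat_mat M)" "- quat_mat (cscale k M) = cscale (cnj k) (- quat_mat M)"
  using bounded_linear_minus[OF bounded_linear_quat_mat] by (simp_all add: quat_mat_def mat2_simps)

text \<open>As \<open>quat_vec\<close> squares to -1, its inverse is its negative; every test
  section on the conjugate surface thus comes from one on the original surface.\<close>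

lemma quat_vec_surj:
  assumes "riemann_surface A" "smooth_on (conj_atlas A) UNIV \<sigma>"
  obtains \<tau> where "smooth_on A UNIV \<tau>" "\<sigma> = (\<lambda>q. quat_vec (\<tau> q))"
proof
  show "smooth_on A UNIV (\<lambda>q. - quat_vec (\<sigma> q))"
    using assms smooth_on_affine[OF assms(1) open_UNIV _ bounded_linear_minus[OF bounded_linear_quat_vec],
      of \<sigma> 0]
    by (simp add: smooth_on_conj_atlas)
  show "\<sigma> = (\<lambda>q. quat_vec (- quat_vec (\<sigma> q)))"
    by (simp add: linear_neg[OF linear_quat_vec])
qed

lemma dbar_op_minus:
  assumes "(f \<circ> chart_inv c) differentiable (at (snd c p))"
  shows "dbar_op \<alpha> c (\<lambda>q. - f q) p = - dbar_op \<alpha> c f p"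
proof -
  obtain F' where F': "((f \<circ> chart_inv c) has_derivative F') (at (snd c p))"
    using assms by (auto simp: differentiable_def)
  have "(((\<lambda>q. - f q) \<circ> chart_inv c) has_derivative (\<lambda>h. - F' h)) (at (snd c p))"
    using has_derivative_minus[OF F'] by (simp add: comp_def)
  then show ?thesis
    by (simp add: dbar_op_def wirtinger_eq(2)[OF F'] wirtinger_eq(2)) (simp add: mat2_simps algebra_simps)
qed

text \<open>On a test section \<open>quat_vec \<tau>\<close>, each order of composition becomes
  \<open>- quat_vec\<close> of the corresponding composition on the original surface, so commutation
  is transported.\<close>

lemma lambda_connection_quat_conj:
  assumes A: "riemann_surface A" and "quat_conj A C C'" and "lambda_connection A l C"
  shows "lambda_connection (conj_atlas A) (- cnj l) C'"
proof -
  obtain \<alpha> \<beta> \<alpha>' \<beta>' where C: "C = (\<alpha>, \<beta>)" "C' = (\<alpha>', \<beta>')" by (metis prod.exhaust)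
  have a: "\<And>c p. c \<in> A \<Longrightarrow> p \<in> fst c \<Longrightarrow> \<alpha>' (conj_chart c) p = quat_mat (\<alpha> c p)"
    and b: "\<And>c p. c \<in> A \<Longrightarrow> p \<in> fst c \<Longrightarrow> \<beta>' (conj_chart c) p = - quat_mat (\<beta> c p)"
    using assms(2) by (auto simp: quat_conj_def C)
  have f: "form01 A \<alpha>" "form10 A \<beta>" and t: "trace_free A \<alpha>" "trace_free A \<beta>"
    and com: "\<And>\<sigma> c p. smooth_on A UNIV \<sigma> \<Longrightarrow> c \<in> A \<Longrightarrow> p \<in> fst c \<Longrightarrow>
        D_op l \<beta> c (dbar_op \<alpha> c \<sigma>) p = dbar_op \<alpha> c (D_op l \<beta> c \<sigma>) p"
    using assms(3) by (auto simp: lambda_connection_def C)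
  have tr: "trace (quat_mat M) = cnj (trace M)" "trace (- quat_mat M) = - cnj (trace M)" for M
    by (simp_all add: quat_mat_def mat2_simps)
  have "trace_free (conj_atlas A) \<alpha>'" "trace_free (conj_atlas A) \<beta>'"
    using t unfolding trace_free_def by (auto simp: a b tr conj_atlas_def)
  moreover have "form01 (conj_atlas A) \<alpha>'"
    using form01_conj[OF A quat_mat_semilinear f(1)] a by blast
  moreover have "form10 (conj_atlas A) \<beta>'"
    using form10_conj[OF A minus_quat_mat_semilinear f(2)] b by blast
  moreover have "D_op (- cnj l) \<beta>' c' (dbar_op \<alpha>' c' \<sigma>) p = dbar_op \<alpha>' c' (D_op (- cnj l) \<beta>' c' \<sigma>) p"
    if s: "smooth_on (conj_atlas A) UNIV \<sigma>" and c': "c' \<in> conj_atlas A" and p': "p \<in> fst c'" for \<sigma> c' p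
  proof -
    define c where "c = conj_chart c'"
    have c: "c \<in> A" "c' = conj_chart c" "p \<in> fst c" using c' p' by (auto simp: c_def)
    obtain \<tau> where \<tau>: "smooth_on A UNIV \<tau>" "\<sigma> = (\<lambda>q. quat_vec (\<tau> q))"
      using quat_vec_surj[OF A s] .
    note d = smooth_on_differentiable[OF \<tau>(1) c(1) UNIV_I]
    have 1: "dbar_op \<alpha>' c' \<sigma> q = quat_vec (dbar_op \<alpha> c \<tau> q)" if "q \<in> fst c" for q
      unfolding \<tau>(2) c(2) by (rule dbar_op_quat_vec[where \<alpha> = \<alpha> and \<alpha>' = \<alpha>', OF A c(1) that d[OF that] a[OF c(1) that]])
    \<comment> \<open>The minus sign sits inside \<open>quat_vec\<close>, so that the outer operator
      again acts on \<open>quat_vec\<close> of a section.\<close>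
    have 2: "D_op (- cnj l) \<beta>' c' \<sigma> q = quat_vec (- D_op l \<beta> c \<tau> q)" if "q \<in> fst c" for q
      unfolding \<tau>(2) c(2) linear_neg[OF linear_quat_vec]
      by (rule D_op_quat_vec[where \<beta> = \<beta> and \<beta>' = \<beta>', OF A c(1) that d[OF that] b[OF c(1) that]])
    have chart: "inj_on (snd c') (fst c')" "open (snd c' ` fst c')"
      using inj_on_conj_chart[OF chart_open(3)[OF A c(1)]] open_cnj_image[OF chart_open(2)[OF A c(1)]]
        conj_chart_image[of c "fst c"] by (simp_all add: c(2))
    \<comment> \<open>The formulas 1 and 2 are valid only on the chart domain; this lets them
      replace the inner operator at \<open>p\<close>.\<close>
    have cong: "dbar_op \<alpha>' c' f p = dbar_op \<alpha>' c' (\<lambda>q. quat_vec (g q)) p"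
        "D_op (- cnj l) \<beta>' c' f p = D_op (- cnj l) \<beta>' c' (\<lambda>q. quat_vec (g q)) p"
      if fg: "\<And>q. q \<in> fst c \<Longrightarrow> f q = quat_vec (g q)"
        "(g \<circ> chart_inv c) differentiable (at (snd c p))" for f g
    proof -
      have "((\<lambda>q. quat_vec (g q)) \<circ> chart_inv c') differentiable (at (snd c' p))"
        using differentiable_quat_vec[OF fg(2)] has_derivative_conj_chart[OF A c(1,3)]
        unfolding differentiable_def c(2) by blast
      from wirtinger_cong[OF chart p' _ this, of f] show
        "dbar_op \<alpha>' c' f p = dbar_op \<alpha>' c' (\<lambda>q. quat_vec (g q)) p"
        "D_op (- cnj l) \<beta>' c' f p = D_op (- cnj l) \<beta>' c' (\<lambda>q. quat_vec (g q)) p"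
        using fg(1) c by (simp_all add: dbar_op_def D_op_def)
    qed
    note db = differentiable_dbar_op[OF A c(1,3) f(1) \<tau>(1)] and dD = differentiable_D_op[OF A c(1,3) f(2) \<tau>(1), of l]
    have dD': "((\<lambda>q. - D_op l \<beta> c \<tau> q) \<circ> chart_inv c) differentiable (at (snd c p))"
      using differentiable_minus[OF dD] by (simp add: comp_def)
    have e2: "D_op (- cnj l) \<beta>' c' (dbar_op \<alpha>' c' \<sigma>) p =
        D_op (- cnj l) \<beta>' c' (\<lambda>q. quat_vec (dbar_op \<alpha> c \<tau> q)) p"
      by (rule cong(2)[OF 1 db])
    have e1: "dbar_op \<alpha>' c' (D_op (- cnj l) \<beta>' c' \<sigma>) p =
        dbar_op \<alpha>' c' (\<lambda>q. quat_vec (- D_op l \<beta> c \<tau> q)) p"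
      by (rule cong(1)[OF 2 dD'])
    have "D_op (- cnj l) \<beta>' c' (dbar_op \<alpha>' c' \<sigma>) p = - quat_vec (D_op l \<beta> c (dbar_op \<alpha> c \<tau>) p)"
      unfolding e2 unfolding c(2) by (rule D_op_quat_vec[where \<beta> = \<beta> and \<beta>' = \<beta>', OF A c(1,3) db b[OF c(1,3)]])
    moreover have "dbar_op \<alpha>' c' (D_op (- cnj l) \<beta>' c' \<sigma>) p =
        quat_vec (dbar_op \<alpha> c (\<lambda>q. - D_op l \<beta> c \<tau> q) p)"
      unfolding e1 unfolding c(2) by (rule dbar_op_quat_vec[where \<alpha> = \<alpha> and \<alpha>' = \<alpha>', OF A c(1,3) dD' a[OF c(1,3)]])
    moreover have "dbar_op \<alpha> c (\<lambda>q. - D_op l \<beta> c \<tau> q) p = - dbar_op \<alpha> c (D_op l \<beta> c \<tau>) p"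
      using dD by (rule dbar_op_minus)
    ultimately show ?thesis
      using com[OF \<tau>(1) c(1,3)] by (simp add: linear_neg[OF linear_quat_vec])
  qed
  ultimately show ?thesis by (simp add: lambda_connection_def C)
qed

text \<open>The transported gauge transformation is \<open>quat_mat (g q)\<close>, because
  \<open>quat_vec\<close> intertwines \<open>g q\<close> with it.\<close>

lemma gauge_equiv_quat_conj:
  assumes A: "riemann_surface A" and "quat_conj A C C'" "quat_conj A E E'" and "gauge_equiv A l C E"
  shows "gauge_equiv (conj_atlas A) (- cnj l) C' E'"
proof -
  obtain \<alpha> \<beta> \<alpha>' \<beta>' where C: "C = (\<alpha>, \<beta>)" "C' = (\<alpha>', \<beta>')" by (metis prod.exhaust)
  obtain \<delta> \<epsilon> \<delta>' \<epsilon>' where E: "E = (\<delta>, \<epsilon>)" "E' = (\<delta>', \<epsilon>')" by (metis prod.exhaust)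
  have C': "\<And>c p. c \<in> A \<Longrightarrow> p \<in> fst c \<Longrightarrow> \<alpha>' (conj_chart c) p = quat_mat (\<alpha> c p)"
      "\<And>c p. c \<in> A \<Longrightarrow> p \<in> fst c \<Longrightarrow> \<beta>' (conj_chart c) p = - quat_mat (\<beta> c p)"
    and E': "\<And>c p. c \<in> A \<Longrightarrow> p \<in> fst c \<Longrightarrow> \<delta>' (conj_chart c) p = quat_mat (\<delta> c p)"
      "\<And>c p. c \<in> A \<Longrightarrow> p \<in> fst c \<Longrightarrow> \<epsilon>' (conj_chart c) p = - quat_mat (\<epsilon> c p)"
    using assms(2,3) by (auto simp: quat_conj_def C E)
  obtain g where g: "smooth_on A UNIV g" "\<And>p. g p \<in> SL2" "gauge_by A l g C E"
    using assms(4) by (auto simp: gauge_equiv_def)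
  have gauge: "g p *v dbar_op \<delta> c \<tau> p = dbar_op \<alpha> c (\<lambda>q. g q *v \<tau> q) p"
      "g p *v D_op l \<epsilon> c \<tau> p = D_op l \<beta> c (\<lambda>q. g q *v \<tau> q) p"
    if "smooth_on A UNIV \<tau>" "c \<in> A" "p \<in> fst c" for \<tau> c p
    using g(3) that by (auto simp: gauge_by_def C E matrix_inv_SL2_eq_iff[OF g(2)])
  have "gauge_by (conj_atlas A) (- cnj l) (\<lambda>q. quat_mat (g q)) C' E'"
    unfolding gauge_by_def C E prod.case matrix_inv_SL2_eq_iff[OF quat_mat_SL2[OF g(2)]]
  proof (intro allI impI ballI)
    fix \<sigma> :: "'a \<Rightarrow> complex^2" and c' p
    assume s: "smooth_on (conj_atlas A) UNIV \<sigma>" and c': "c' \<in> conj_atlas A" and p': "p \<in> fst c'"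
    define c where "c = conj_chart c'"
    have c: "c \<in> A" "c' = conj_chart c" "p \<in> fst c" using c' p' by (auto simp: c_def)
    obtain \<tau> where \<tau>: "smooth_on A UNIV \<tau>" "\<sigma> = (\<lambda>q. quat_vec (\<tau> q))"
      using quat_vec_surj[OF A s] .
    note d = smooth_on_differentiable[OF \<tau>(1) c(1) UNIV_I c(3)]
    note dg = differentiable_mv[OF smooth_on_differentiable[OF g(1) c(1) UNIV_I c(3)] d]
    have eq: "(\<lambda>q. quat_mat (g q) *v quat_vec (\<tau> q)) = (\<lambda>q. quat_vec (g q *v \<tau> q))"
      by (simp add: quat_vec_mult)
    have neg: "M *v (- v) = - (M *v v)" for M :: cmat and v
      by (simp add: mat2_simps)
    show "quat_mat (g p) *v dbar_op \<delta>' c' \<sigma> p = dbar_op \<alpha>' c' (\<lambda>q. quat_mat (g q) *v \<sigma> q) p \<and>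
        quat_mat (g p) *v D_op (- cnj l) \<epsilon>' c' \<sigma> p = D_op (- cnj l) \<beta>' c' (\<lambda>q. quat_mat (g q) *v \<sigma> q) p"
      unfolding \<tau>(2) eq c(2)
        dbar_op_quat_vec[where \<alpha>' = \<alpha>' and \<alpha> = \<alpha>, OF A c(1,3) dg C'(1)[OF c(1,3)]]
        dbar_op_quat_vec[where \<alpha>' = \<delta>' and \<alpha> = \<delta>, OF A c(1,3) d E'(1)[OF c(1,3)]]
        D_op_quat_vec[where \<beta>' = \<beta>' and \<beta> = \<beta>, OF A c(1,3) dg C'(2)[OF c(1,3)]]
        D_op_quat_vec[where \<beta>' = \<epsilon>' and \<beta> = \<epsilon>, OF A c(1,3) d E'(2)[OF c(1,3)]]
        neg quat_vec_mult[symmetric] gauge[OF \<tau>(1) c(1,3)]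
      by simp
  qed
  moreover have "smooth_on (conj_atlas A) UNIV (\<lambda>q. quat_mat (g q))"
    using smooth_on_affine[OF A open_UNIV g(1) bounded_linear_quat_mat, of 0]
    by (simp add: smooth_on_conj_atlas[OF A open_UNIV])
  ultimately show ?thesis using quat_mat_SL2[OF g(2)] by (auto simp: gauge_equiv_def)
qed

section \<open>Pairs adapted to the Hermitian structure\<close>

text \<open>The first clause says that the connection commutes with the quaternionic structure, the
  second that the Higgs field is trace-free. Stated through \<open>quat_mat\<close>, both are easily
  followed under gauge transformations.\<close>

definition unitary_pair :: "'a chart set \<Rightarrow> 'a pair \<Rightarrow> bool" where
  "unitary_pair A S \<longleftrightarrow> (case S of (\<alpha>, \<beta>, \<phi>) \<Rightarrow>
     \<forall>c\<in>A. \<forall>p\<in>fst c. quat_mat (\<alpha> c p) = \<beta> c p \<and> quat_mat (\<phi> c p) = - adj_mat (\<phi> c p))"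

lemma sd_solution_unitary_pair:
  assumes "sd_solution A S"
  shows "unitary_pair A S"
proof -
  obtain \<alpha> \<beta> \<phi> where S: "S = (\<alpha>, \<beta>, \<phi>)" by (metis prod.exhaust)
  have "quat_mat (\<alpha> c p) = \<beta> c p \<and> quat_mat (\<phi> c p) = - adj_mat (\<phi> c p)"
    if c: "c \<in> A" "p \<in> fst c" for c p
  proof -
    have "\<alpha> c p = - adj_mat (\<beta> c p)" "trace (\<beta> c p) = 0" "trace (\<phi> c p) = 0"
      using assms c unfolding sd_solution_def S prod.case trace_free_def by blast+
    then show ?thesis
      using quat_mat_trace_free[of "\<beta> c p"] quat_mat_trace_free[of "\<phi> c p"]
      by (metis quat_mat_quat_mat)
  qed
  then show ?thesis by (simp add: unitary_pair_def S)
qed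

text \<open>The quaternionic structure swaps \<alpha> with \<beta> and \<phi> with minus its
  adjoint. Together with the minus sign in \<open>- cnj m\<close> this yields exactly the
  coefficients of the family around infinity.\<close>

lemma hodge_quat_conj:
  assumes "unitary_pair A S"
  shows "quat_conj A (hodge S (- cnj m)) (hodge_conj S m)"
proof -
  obtain \<alpha> \<beta> \<phi> where S: "S = (\<alpha>, \<beta>, \<phi>)" by (metis prod.exhaust)
  note lin = linear_add[OF bounded_linear.linear[OF bounded_linear_quat_mat]]
    linear_neg[OF bounded_linear.linear[OF bounded_linear_quat_mat]]
    linear_diff[OF bounded_linear.linear[OF bounded_linear_quat_mat]]
  have "fst (hodge_conj S m) (conj_chart c) p = quat_mat (fst (hodge S (- cnj m)) c p)
      \<and> snd (hodge_conj S m) (conj_chart c) p = - quat_mat (snd (hodge S (- cnj m)) c p)"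
    if c: "c \<in> A" "p \<in> fst c" for c p
  proof -
    have u: "\<beta> c p = quat_mat (\<alpha> c p)" "adj_mat (\<phi> c p) = - quat_mat (\<phi> c p)"
      using assms c unfolding unitary_pair_def S by auto
    have neg: "cscale (- k) M = - cscale k M" "cscale k (- M) = - cscale k M" for k M
      by (simp_all add: mat2_simps)
    show ?thesis
      unfolding S by (simp add: hodge_def hodge_conj_def to_conj_def add_form_def scale_form_def
        adj_form_def u lin quat_mat_cscale neg)
  qed
  then show ?thesis by (simp add: quat_conj_def)
qed

text \<open>The adjoint of \<open>quat_mat g\<close> is the adjugate of \<open>g\<close>, which is
  the inverse when the determinant is 1; by unitarity \<open>adj_mat g\<close> is the inverse
  too.\<close>

lemma quat_mat_SU2:
  assumes "g \<in> SU2"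
  shows "quat_mat g = g"
proof -
  have g: "det g = 1" "g ** adj_mat g = mat 1" using assms by (auto simp: SU2_def)
  then have gg: "adj_mat g ** g = mat 1" using matrix_left_right_inverse by blast
  have "g ** adj_mat (quat_mat g) = mat 1"
    using g(1) by (simp add: det_2 quat_mat_def adj_mat_def mat2_simps algebra_simps)
  then have "adj_mat g ** (g ** adj_mat (quat_mat g)) = adj_mat g" by simp
  then have "adj_mat (quat_mat g) = adj_mat g" by (simp add: matrix_mul_assoc gg)
  then show ?thesis by (simp add: adj_mat_def mat2_simps)
qed

lemma wirtinger_const [simp]:
  "wirtinger c (\<lambda>q. v) p = 0" "wirtinger_bar c (\<lambda>q. v) p = 0"
  by (simp_all add: wirtinger_def wirtinger_bar_def comp_def mat2_simps)

text \<open>The definition of the moduli space does not say that gauge transforms of solutions are solutions;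
  the part of this that is needed holds because special unitary matrices commute with the
  quaternionic structure.\<close>

lemma unitary_pair_gauge:
  assumes A: "riemann_surface A" and "unitary_pair A S" and "(S, S') \<in> sd_gauge_rel A"
  shows "unitary_pair A S'"
proof -
  obtain \<alpha> \<beta> \<phi> \<alpha>' \<beta>' \<phi>' where S: "S = (\<alpha>, \<beta>, \<phi>)" "S' = (\<alpha>', \<beta>', \<phi>')" by (metis prod.exhaust)
  obtain g where g: "smooth_on A UNIV g" "\<And>p. g p \<in> SU2"
    and gb: "gauge_by A 1 g (\<alpha>, \<beta>) (\<alpha>', \<beta>')" "gauge_by A 0 g (\<alpha>, \<phi>) (\<alpha>', \<phi>')"
    using assms(3) by (auto simp: sd_gauge_rel_def S)
  have SL: "g p \<in> SL2" for p using g(2)[of p] by (simp add: SU2_def SL2_def)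
  have "quat_mat (\<alpha>' c p) = \<beta>' c p \<and> quat_mat (\<phi>' c p) = - adj_mat (\<phi>' c p)"
    if c: "c \<in> A" "p \<in> fst c" for c p
  proof -
    have u: "quat_mat (\<alpha> c p) = \<beta> c p" "quat_mat (\<phi> c p) = - adj_mat (\<phi> c p)"
      using assms(2) c unfolding unitary_pair_def S by auto
    \<comment> \<open>On constant test sections the derivative of the section vanishes and the gauge
      law reads off the new coefficients.\<close>
    have a: "g p *v (\<alpha>' c p *v v) = wirtinger_bar c (\<lambda>q. g q *v v) p + \<alpha> c p *v (g p *v v)"
      and b: "g p *v (\<beta>' c p *v v) = wirtinger c (\<lambda>q. g q *v v) p + \<beta> c p *v (g p *v v)"
      and f: "g p *v (\<phi>' c p *v v) = \<phi> c p *v (g p *v v)" for v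
      using gb smooth_on_const[OF A open_UNIV, of v] c
      by (auto simp: gauge_by_def matrix_inv_SL2_eq_iff[OF SL] dbar_op_def D_op_def)
    have d: "((\<lambda>q. g q *v v) \<circ> chart_inv c) differentiable (at (snd c p))" for v
      using smooth_on_differentiable[OF g(1) c(1) UNIV_I c(2)]
        smooth_on_differentiable[OF smooth_on_const[OF A open_UNIV, of v] c(1) UNIV_I c(2)]
      by (rule differentiable_mv)
    have "quat_mat (\<alpha>' c p) *v quat_vec v = \<beta>' c p *v quat_vec v" for v
    proof -
      have "g p *v (quat_mat (\<alpha>' c p) *v quat_vec v) = quat_vec (g p *v (\<alpha>' c p *v v))"
        by (simp add: quat_vec_mult quat_mat_SU2[OF g(2)])
      also have "\<dots> = wirtinger c (\<lambda>q. quat_vec (g q *v v)) p + \<beta> c p *v (g p *v quat_vec v)"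
        unfolding a linear_add[OF linear_quat_vec] wirtinger_quat_vec(1)[OF d]
        by (simp add: quat_vec_mult quat_mat_SU2[OF g(2)] u)
      also have "\<dots> = g p *v (\<beta>' c p *v quat_vec v)"
        by (simp add: b quat_vec_mult quat_mat_SU2[OF g(2)])
      finally show ?thesis
        using matrix_inv_SL2_eq_iff[OF SL] by metis
    qed
    then have "quat_mat (\<alpha>' c p) *v v = \<beta>' c p *v v" for v
      by (metis quat_vec_quat_vec minus_minus)
    then have 1: "quat_mat (\<alpha>' c p) = \<beta>' c p" by (simp add: matrix_eq)
    have adj_mult: "adj_mat (M ** N) = adj_mat N ** adj_mat M"
      and quat_mult: "quat_mat (M ** N) = quat_mat M ** quat_mat N" for M N
      by (simp_all add: adj_mat_def quat_mat_def mat2_simps algebra_simps)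
    have gg: "g p ** adj_mat (g p) = mat 1" "adj_mat (g p) ** g p = mat 1"
      using g(2)[of p] matrix_left_right_inverse by (auto simp: SU2_def)
    have f': "g p ** \<phi>' c p = \<phi> c p ** g p"
      using f by (simp add: matrix_eq matrix_vector_mul_assoc[symmetric])
    \<comment> \<open>Conjugation by \<open>g\<close> commutes with taking adjoints since
      \<open>g\<close> is unitary, and with \<open>quat_mat\<close> since that is multiplicative and
      fixes \<open>g\<close>.\<close>
    have "g p ** adj_mat (\<phi>' c p) = g p ** (adj_mat (g p ** \<phi>' c p) ** g p)"
      by (simp add: adj_mult gg flip: matrix_mul_assoc)
    also have "\<dots> = adj_mat (\<phi> c p) ** g p"
      unfolding f' by (simp add: adj_mult gg matrix_mul_assoc)
    also have "\<dots> = - (quat_mat (\<phi> c p) ** quat_mat (g p))"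
      unfolding u quat_mat_SU2[OF g(2)] by (simp add: mat2_simps)
    also have "\<dots> = - (g p ** quat_mat (\<phi>' c p))"
      unfolding quat_mult[symmetric] f'[symmetric] unfolding quat_mult quat_mat_SU2[OF g(2)] ..
    finally have "adj_mat (g p) ** (g p ** adj_mat (\<phi>' c p)) = adj_mat (g p) ** (- (g p ** quat_mat (\<phi>' c p)))"
      by simp
    also have "\<dots> = - (adj_mat (g p) ** (g p ** quat_mat (\<phi>' c p)))"
      by (simp add: mat2_simps algebra_simps)
    finally have "adj_mat (\<phi>' c p) = - quat_mat (\<phi>' c p)"
      by (simp add: matrix_mul_assoc gg)
    with 1 show ?thesis by simp
  qed
  then show ?thesis by (simp add: unitary_pair_def S)
qed

text \<open>A point of the moduli space is the class of some solution, and its other members are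
  known only to be gauge related to that solution.\<close>

lemma dh_section_unitary_pair:
  assumes "riemann_surface A" "dh_section A s" "S \<in> fst (s x)"
  shows "unitary_pair A S"
proof -
  have "fst (s x) \<in> M_SD_irr A"
    using assms(2) unfolding dh_section_def M_DH_def by (metis mem_Times_iff)
  then obtain S0 where "sd_solution A S0" "fst (s x) = sd_gauge_rel A `` {S0}"
    unfolding M_SD_irr_def by (auto elim!: quotientE)
  then show ?thesis
    using assms(3) unitary_pair_gauge[OF assms(1) sd_solution_unitary_pair] by auto
qed

section \<open>The lift around infinity and the parity\<close>

text \<open>Each fibre is obtained by transporting the representation at \<open>- cnj m\<close>
  through the quaternionic structure; reality of \<open>s\<close> then identifies the underlying
  class with the one at the antipode.\<close>

lemma hodge_conj_lift:
  assumes A: "riemann_surface A" and S: "sd_solution A S" and s: "tau_real A s"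
    and lift: "lift_on A s UNIV (hodge S)"
  shows "lift_conj_on A s UNIV (hodge_conj S)"
proof -
  obtain \<alpha> \<beta> \<phi> where Seq: "S = (\<alpha>, \<beta>, \<phi>)" by (metis prod.exhaust)
  have conj: "quat_conj A (hodge S (- cnj m)) (hodge_conj S m)" for m
    by (rule hodge_quat_conj[OF sd_solution_unitary_pair[OF S]])
  have "(\<lambda>m. fst (hodge_conj S m) c p $ i $ j) holomorphic_on UNIV"
    "(\<lambda>m. snd (hodge_conj S m) c p $ i $ j) holomorphic_on UNIV" for c p i j
    by (auto simp: Seq hodge_conj_def to_conj_def add_form_def scale_form_def cscale_def
        intro!: holomorphic_intros)
  note hol = this
  have lift': "holomorphic_form_family A UNIV (\<lambda>l. fst (hodge S l))"
    "holomorphic_form_family A UNIV (\<lambda>l. snd (hodge S l))"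
    using lift by (auto simp: lift_on_def)
  have "holomorphic_form_family (conj_atlas A) UNIV (\<lambda>m. fst (hodge_conj S m))"
    by (rule holomorphic_form_family_conj[OF A quat_mat_semilinear lift'(1) _ hol(1)])
      (use conj in \<open>auto simp: quat_conj_def\<close>)
  moreover have "holomorphic_form_family (conj_atlas A) UNIV (\<lambda>m. snd (hodge_conj S m))"
    by (rule holomorphic_form_family_conj[OF A minus_quat_mat_semilinear lift'(2) _ hol(2)])
      (use conj in \<open>auto simp: quat_conj_def\<close>)
  moreover have "represents_conj A s m (hodge_conj S m)" for m
  proof -
    have "represents A s (- cnj m) (hodge S (- cnj m))"
      using lift by (simp add: lift_on_def)
    then obtain S' where S': "lambda_connection A (- cnj m) (hodge S (- cnj m))"
      "S' \<in> fst (s (Pt (- cnj m)))" "gauge_equiv A (- cnj m) (hodge S' (- cnj m)) (hodge S (- cnj m))"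
      by (auto simp: represents_def)
    have e: "s (Pt (- cnj m)) = tau (s (antipode (Pt (- cnj m))))"
      using s unfolding tau_real_def by blast
    \<comment> \<open>For \<open>m = 0\<close> the antipode is infinity, so that fibre needs no
      separate argument.\<close>
    have "antipode (Pt (- cnj m)) = (if m = 0 then Infty else Pt (inverse m))"
      by (simp add: antipode_def)
    then have "fst (s (Pt (- cnj m))) = fst (s (if m = 0 then Infty else Pt (inverse m)))"
      by (subst e) (simp add: tau_def)
    moreover have "unitary_pair A S'"
      using dh_section_unitary_pair[where s = s, OF A _ S'(2)] s by (simp add: tau_real_def)
    then have "quat_conj A (hodge S' (- cnj m)) (hodge_conj S' m)" by (rule hodge_quat_conj)
    ultimately show ?thesis
      using S'(2) lambda_connection_quat_conj[OF A conj S'(1)]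
        gauge_equiv_quat_conj[OF A _ conj S'(3), of "hodge_conj S' m"]
      unfolding represents_conj_def complex_cnj_minus complex_cnj_cnj minus_minus by blast
  qed
  ultimately show ?thesis by (simp add: lift_conj_on_def)
qed

text \<open>Both lifts come from the same solution and give the same flat connections, so the
  constant identity glues them and its determinant has winding number 0.\<close>

lemma hodge_parity:
  assumes A: "riemann_surface A" and S: "sd_solution A S" and s: "tau_real A s"
    and lift: "lift_on A s UNIV (hodge S)"
  shows "has_parity A s 0"
proof -
  obtain \<alpha> \<beta> \<phi> where Seq: "S = (\<alpha>, \<beta>, \<phi>)" by (metis prod.exhaust)
  have flat: "flat_family_conj (hodge_conj S) l = flat_family (hodge S) l" if "l \<noteq> 0" for l
    using that by (simp add: Seq flat_family_conj_def flat_family_def hodge_def hodge_conj_def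
      to_conj_def add_form_def scale_form_def adj_form_def fun_eq_iff mat2_simps field_simps)
  have inv: "matrix_inv (mat 1 :: cmat) = mat 1"
    using matrix_inv_SL2(1)[of "mat 1"] by (simp add: SL2_def)
  have "holomorphic_gauge_family A (- {0}) (\<lambda>l p. mat 1)"
    using chart_open(2)[OF A]
    by (auto simp: holomorphic_gauge_family_def holomorphic_form_family_def case_prod_unfold
      intro!: Cinf_on_const open_Times)
  moreover have "mat 1 \<in> GL2" by (simp add: GL2_def invertible_det_nz)
  moreover have "gauge_by A 1 (\<lambda>p. mat 1) C C" for C
    by (simp add: gauge_by_def inv split: prod.split)
  moreover have "winding_number (\<lambda>t. 1) 0 = 0"
    using winding_number_trivial[of 0 1] by (simp add: linepath_def algebra_simps)
  ultimately show ?thesis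
    unfolding has_parity_def using lift hodge_conj_lift[OF assms] flat
    by (intro exI[of _ "hodge S"] exI[of _ "hodge_conj S"] exI[of _ "\<lambda>l p. mat 1"])
      (auto intro!: exI[of _ 0])
qed

section \<open>Parallel endomorphisms\<close>

text \<open>The matrix of the flat connection \<open>dbar + l\<^sup>-\<^sup>1 D\<close> in direction \<open>v\<close>.\<close>

definition conn_mat :: "complex \<Rightarrow> 'a conn \<Rightarrow> 'a chart \<Rightarrow> 'a \<Rightarrow> complex \<Rightarrow> cmat" where
  "conn_mat l C c p v = cscale (v / l) (snd C c p) + cscale (cnj v) (fst C c p)"

text \<open>This is \<open>dN + [B, N] = 0\<close> for the connection matrix \<open>B\<close>: the
  covariant derivative on endomorphisms vanishes, expressed through the real derivative in a
  chart.\<close>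

definition parallel_endo :: "'a::t2_space chart set \<Rightarrow> complex \<Rightarrow> 'a conn \<Rightarrow> ('a \<Rightarrow> cmat) \<Rightarrow> bool" where
  "parallel_endo A l C N \<longleftrightarrow> (\<forall>c\<in>A. \<forall>p\<in>fst c. ((N \<circ> chart_inv c) has_derivative
     (\<lambda>v. N p ** conn_mat l C c p v - conn_mat l C c p v ** N p)) (at (snd c p)))"

text \<open>Testing the gauge law on constant sections gives the two Wirtinger derivatives of
  \<open>h\<close>; the one in the holomorphic direction appears multiplied by \<open>l\<close>,
  which is nonzero. Together they determine the full derivative.\<close>

lemma automorphism_parallel:
  assumes A: "riemann_surface A" and l: "l \<noteq> 0"
    and h: "smooth_on A UNIV h" "\<And>p. h p \<in> SL2" "gauge_by A l h C C"
  shows "parallel_endo A l C h"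
  unfolding parallel_endo_def
proof (intro ballI)
  fix c p assume c: "c \<in> A" "p \<in> fst c"
  obtain \<alpha> \<beta> where C: "C = (\<alpha>, \<beta>)" by (metis prod.exhaust)
  obtain H where H: "((h \<circ> chart_inv c) has_derivative H) (at (snd c p))"
    using smooth_on_has_derivative[OF h(1) c(1) UNIV_I c(2)] .
  let ?\<alpha> = "\<alpha> c p" and ?\<beta> = "\<beta> c p"
  have He: "(((\<lambda>q. h q *v e) \<circ> chart_inv c) has_derivative (\<lambda>v. H v *v e)) (at (snd c p))" for e
    using bounded_linear.has_derivative[OF bounded_bilinear.bounded_linear_left[OF bilinear_mv] H]
    by (simp add: comp_def)
  have eq: "h p *v (?\<alpha> *v e) = (1/2) *s (H 1 *v e + \<i> *s (H \<i> *v e)) + ?\<alpha> *v (h p *v e)"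
    "h p *v (?\<beta> *v e) = l *s ((1/2) *s (H 1 *v e - \<i> *s (H \<i> *v e))) + ?\<beta> *v (h p *v e)" for e
    using h(3) smooth_on_const[OF A open_UNIV, of e] c wirtinger_eq[OF He]
    by (auto simp: gauge_by_def C matrix_inv_SL2_eq_iff[OF h(2)] dbar_op_def D_op_def)
  have mat: "h p ** ?\<alpha> = cscale (1/2) (H 1 + cscale \<i> (H \<i>)) + ?\<alpha> ** h p"
    "h p ** ?\<beta> = cscale l (cscale (1/2) (H 1 - cscale \<i> (H \<i>))) + ?\<beta> ** h p"
    using eq unfolding matrix_eq
    by (simp_all add: matrix_vector_mul_assoc[symmetric])
      (simp_all add: mat2_simps algebra_simps)
  have "H v = h p ** conn_mat l C c p v - conn_mat l C c p v ** h p" for v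
  proof -
    have "Re v *\<^sub>R 1 + Im v *\<^sub>R \<i> = v" by (simp add: complex_eq_iff)
    then have "H v = H (Re v *\<^sub>R 1 + Im v *\<^sub>R \<i>)" by simp
    also have "\<dots> = Re v *\<^sub>R H 1 + Im v *\<^sub>R H \<i>"
      using has_derivative_linear[OF H] by (simp add: linear_add linear_scale)
    finally have Hv: "H v = Re v *\<^sub>R H 1 + Im v *\<^sub>R H \<i>" .
    define a where "a = h p ** ?\<alpha> - ?\<alpha> ** h p"
    define b where "b = h p ** ?\<beta> - ?\<beta> ** h p"
    have "h p ** conn_mat l C c p v - conn_mat l C c p v ** h p = cscale (v / l) b + cscale (cnj v) a"
      by (simp add: a_def b_def conn_mat_def C mat2_simps algebra_simps)
    moreover have "a = cscale (1/2) (H 1 + cscale \<i> (H \<i>))"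
      "b = cscale l (cscale (1/2) (H 1 - cscale \<i> (H \<i>)))"
      using mat by (auto simp: a_def b_def)
    \<comment> \<open>A real derivative in direction \<open>v\<close> is \<open>v\<close> times the
      Wirtinger derivative plus \<open>cnj v\<close> times the conjugate one.\<close>
    moreover have "Re v *\<^sub>R x + Im v *\<^sub>R y =
        v / l * (l * (1/2 * (x - \<i> * y))) + cnj v * (1/2 * (x + \<i> * y))" for x y :: complex
    proof -
      have v: "(v + cnj v) / 2 = of_real (Re v)" "\<i> * (v - cnj v) / 2 = - of_real (Im v)"
        by (simp_all add: complex_eq_iff)
      have "v / l * (l * (1/2 * (x - \<i> * y))) + cnj v * (1/2 * (x + \<i> * y))
          = (v + cnj v) / 2 * x - \<i> * (v - cnj v) / 2 * y"
        using l by (simp add: field_simps)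
      then show ?thesis unfolding v by (simp add: scaleR_conv_of_real)
    qed
    ultimately show ?thesis
      unfolding Hv by (simp add: vec_eq_iff cscale_def)
  qed
  then have "H = (\<lambda>v. h p ** conn_mat l C c p v - conn_mat l C c p v ** h p)" by blast
  then show "((h \<circ> chart_inv c) has_derivative (\<lambda>v. h p ** conn_mat l C c p v - conn_mat l C c p v ** h p))
      (at (snd c p))" using H by simp
qed

text \<open>Scalar matrices are constant and central, so an eigenvalue may be subtracted.\<close>

lemma parallel_endo_diff_mat:
  assumes "parallel_endo A l C h"
  shows "parallel_endo A l C (\<lambda>p. h p - mat k)"
  unfolding parallel_endo_def
proof (intro ballI)
  fix c p assume "c \<in> A" "p \<in> fst c"
  then have "((h \<circ> chart_inv c) has_derivative
      (\<lambda>v. h p ** conn_mat l C c p v - conn_mat l C c p v ** h p)) (at (snd c p))"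
    using assms unfolding parallel_endo_def by blast
  from has_derivative_diff[OF this has_derivative_const[of "mat k"]]
  have "(((\<lambda>p. h p - mat k) \<circ> chart_inv c) has_derivative
      (\<lambda>v. h p ** conn_mat l C c p v - conn_mat l C c p v ** h p)) (at (snd c p))"
    by (simp add: comp_def)
  moreover have "h p ** M - M ** h p = (h p - mat k) ** M - M ** (h p - mat k)" for M
    by (simp add: mat2_simps algebra_simps)
  ultimately show "(((\<lambda>p. h p - mat k) \<circ> chart_inv c) has_derivative
      (\<lambda>v. (h p - mat k) ** conn_mat l C c p v - conn_mat l C c p v ** (h p - mat k))) (at (snd c p))"
    by simp
qed

lemma chart_nhd:
  assumes "riemann_surface A" "c \<in> A" "p \<in> fst c" "open S" "snd c p \<in> S"
  shows "eventually (\<lambda>q. q \<in> fst c \<and> snd c q \<in> S) (nhds p)"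
proof -
  have "open (fst c \<inter> snd c -` S)"
    using continuous_open_preimage[OF continuous_on_chart[OF assms(1,2)] chart_open(1)[OF assms(1,2)] assms(4)] .
  then show ?thesis using assms(3,5) by (auto simp: eventually_nhds)
qed

text \<open>The derivative is a commutator, hence has trace 0. The trace is therefore constant on
  chart discs, and globally by connectedness.\<close>

lemma parallel_trace_const:
  assumes A: "riemann_surface A" and con: "connected (UNIV :: 'a::t2_space set)"
    and N: "parallel_endo A l C N"
  shows "trace (N p) = trace (N (q :: 'a))"
proof (rule connected_local_const[OF con UNIV_I UNIV_I], intro ballI)
  fix p :: 'a
  obtain c where c: "c \<in> A" "p \<in> fst c" using chart_exists[OF A] .
  obtain e where e: "e > 0" "ball (snd c p) e \<subseteq> snd c ` fst c"
    using chart_open(2)[OF A c(1)] c(2) open_contains_ball by blast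
  have tr: "bounded_linear (trace :: cmat \<Rightarrow> complex)"
    unfolding linear_conv_bounded_linear[symmetric] by (intro linearI) (simp_all add: mat2_simps algebra_simps)
  have "((\<lambda>z. trace (N (chart_inv c z))) has_derivative (\<lambda>v. 0)) (at z within ball (snd c p) e)"
    if "z \<in> ball (snd c p) e" for z
  proof -
    obtain q where q: "q \<in> fst c" "z = snd c q" using e(2) \<open>z \<in> _\<close> by auto
    have "((N \<circ> chart_inv c) has_derivative
        (\<lambda>v. N q ** conn_mat l C c q v - conn_mat l C c q v ** N q)) (at z)"
      using N c(1) q unfolding parallel_endo_def by blast
    from bounded_linear.has_derivative[OF tr this]
    have "((\<lambda>z. trace (N (chart_inv c z))) has_derivative (\<lambda>v. 0)) (at z)"
      by (simp add: comp_def trace_sub trace_mul_sym[of "N q"])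
    then show ?thesis by (rule has_derivative_at_withinI)
  qed
  from has_derivative_zero_constant[OF convex_ball this]
  obtain t where t: "\<And>z. z \<in> ball (snd c p) e \<Longrightarrow> trace (N (chart_inv c z)) = t" by blast
  have "eventually (\<lambda>q. trace (N p) = trace (N q)) (nhds p)"
  proof (rule eventually_mono[OF chart_nhd[OF A c open_ball, of _ e]])
    show "snd c p \<in> ball (snd c p) e" using e(1) by simp
    show "trace (N p) = trace (N q)" if "q \<in> fst c \<and> snd c q \<in> ball (snd c p) e" for q
      using t[of "snd c p"] t[of "snd c q"] that e(1) c(2) chart_open(3)[OF A c(1)] by simp
  qed
  then show "eventually (\<lambda>q. trace (N p) = trace (N q)) (at p within UNIV)"
    by (simp add: eventually_at_filter eventually_mono)
qed

lemma smooth_on_subset: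
  assumes "riemann_surface A" "open V" "V \<subseteq> W" "smooth_on A W f"
  shows "smooth_on A V f"
  unfolding smooth_on_def
proof
  fix c assume c: "c \<in> A"
  have f: "Cinf_on (snd c ` (W \<inter> fst c)) (f \<circ> chart_inv c)"
    using assms(4) c unfolding smooth_on_def by blast
  have "Cinf_on (snd c ` (V \<inter> fst c)) (\<lambda>x. (f \<circ> chart_inv c) (0 + x) + 0)"
    by (rule Cinf_on_affine[where T = "\<lambda>x. x" and Q = "\<lambda>x. x", OF f
        open_chart_image[OF assms(1) c assms(2)] bounded_linear_ident bounded_linear_ident])
      (use assms(3) in auto)
  then show "Cinf_on (snd c ` (V \<inter> fst c)) (f \<circ> chart_inv c)"
    by (simp add: comp_def)
qed

text \<open>A linear differential inequality for parallel endomorphisms, with \<open>K\<close>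
  depending only on the bounds of the bilinear operations.\<close>

lemma conn_mat_bound:
  obtains K where "K > 0"
    and "\<And>l C c p v N. norm (N ** conn_mat l C c p v - conn_mat l C c p v ** N) \<le>
      K * (norm (snd C c p) / norm l + norm (fst C c p)) * norm N * norm v"
proof -
  obtain a where a: "a > 0" "\<And>k M. norm (cscale k M) \<le> norm k * norm M * a"
    using bounded_bilinear.pos_bounded[OF bilinear_cscale] by blast
  obtain b where b: "b > 0" "\<And>(M :: cmat) (N :: cmat). norm (M ** N) \<le> norm M * norm N * b"
    using bounded_bilinear.pos_bounded[OF bilinear_mm] by blast
  have "norm (N ** conn_mat l C c p v - conn_mat l C c p v ** N) \<le>
      (2 * b * a) * (norm (snd C c p) / norm l + norm (fst C c p)) * norm N * norm v" for l and C :: "'a conn" and c p v N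
  proof -
    let ?B = "conn_mat l C c p v"
    have "norm ?B \<le> norm (cscale (v / l) (snd C c p)) + norm (cscale (cnj v) (fst C c p))"
      unfolding conn_mat_def by (rule norm_triangle_ineq)
    also have "\<dots> \<le> norm (v / l) * norm (snd C c p) * a + norm (cnj v) * norm (fst C c p) * a"
      by (intro add_mono a(2))
    also have "\<dots> = a * (norm (snd C c p) / norm l + norm (fst C c p)) * norm v"
      by (simp add: norm_divide field_simps)
    finally have B: "norm ?B \<le> a * (norm (snd C c p) / norm l + norm (fst C c p)) * norm v" .
    have "norm (N ** ?B - ?B ** N) \<le> norm (N ** ?B) + norm (?B ** N)"
      by (rule norm_triangle_ineq4)
    also have "\<dots> \<le> norm N * norm ?B * b + norm ?B * norm N * b"
      by (intro add_mono b(2))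
    also have "\<dots> = 2 * b * norm N * norm ?B" by (simp add: field_simps)
    also have "\<dots> \<le> 2 * b * norm N * (a * (norm (snd C c p) / norm l + norm (fst C c p)) * norm v)"
      using B b(1) by (intro mult_left_mono) auto
    finally show ?thesis by (simp add: mult_ac)
  qed
  then show ?thesis using that[of "2 * b * a"] a(1) b(1) by auto
qed

text \<open>On a disc of radius \<open>r\<close> around a zero, the mean value inequality bounds the supremum of \<open>|N|\<close> by \<open>B r\<close> times
  itself.\<close>

lemma parallel_zero_open:
  assumes A: "riemann_surface A" and C: "lambda_connection A l C"
    and N: "parallel_endo A l C N" and zero: "N p = 0"
  shows "eventually (\<lambda>q. N q = 0) (nhds p)"
proof -
  obtain c where c: "c \<in> A" "p \<in> fst c" using chart_exists[OF A] .
  define z where "z = snd c p"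
  obtain r0 where r0: "r0 > 0" "cball z r0 \<subseteq> snd c ` fst c"
    using chart_open(2)[OF A c(1)] c(2) open_contains_cball unfolding z_def by blast
  have "smooth_on A (fst c) (fst C c)" "smooth_on A (fst c) (snd C c)"
    using C c(1) by (auto simp: lambda_connection_def form01_def form10_def split: prod.splits)
  then have "continuous_on (snd c ` fst c) (fst C c \<circ> chart_inv c)"
    "continuous_on (snd c ` fst c) (snd C c \<circ> chart_inv c)"
    using c(1) unfolding smooth_on_def Cinf_on_def by (metis Ck_on.simps(1) Int_absorb)+
  note cont = this[THEN continuous_on_subset, OF r0(2)]
  define K0 where "K0 = (\<lambda>w. norm (snd C c (chart_inv c w)) / norm l + norm (fst C c (chart_inv c w)))"
  have "continuous_on (cball z r0) K0"
    using cont unfolding K0_def divide_inverse comp_def by (intro continuous_intros)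
  then obtain w0 where w0: "\<And>w. w \<in> cball z r0 \<Longrightarrow> K0 w \<le> K0 w0"
    using continuous_attains_sup[OF compact_cball, of z r0 K0] r0(1) by fastforce
  obtain K where K: "K > 0" "\<And>C c p v N. norm (N ** conn_mat l C c p v - conn_mat l C c p v ** N) \<le>
      K * (norm (snd C c p) / norm l + norm (fst (C :: 'a conn) c p)) * norm N * norm v"
    using conn_mat_bound by metis
  \<comment> \<open>The added 1 makes \<open>B\<close> positive even if the connection matrix
    vanishes on the disc.\<close>
  define B where "B = K * \<bar>K0 w0\<bar> + 1"
  have B: "B > 0" "K * K0 w \<le> B" if "w \<in> cball z r0" for w
  proof -
    show "B > 0" using K(1) by (simp add: B_def add_nonneg_pos)
    have "K * K0 w \<le> K * \<bar>K0 w0\<bar>"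
      using w0[OF that] K(1) by (intro mult_left_mono) auto
    then show "K * K0 w \<le> B" by (simp add: B_def)
  qed
  have Bpos: "B > 0" using B(1)[of z] r0(1) by simp
  \<comment> \<open>The radius is chosen so that \<open>B * r\<close> is at most one half, which
    makes the estimate below contracting.\<close>
  define r where "r = min r0 (1 / (2 * B))"
  have r: "r > 0" "r \<le> r0" "B * r \<le> 1/2"
    using r0(1) Bpos by (auto simp: r_def min_def field_simps)
  let ?f = "N \<circ> chart_inv c"
  let ?E = "\<lambda>w v. ?f w ** conn_mat l C c (chart_inv c w) v - conn_mat l C c (chart_inv c w) v ** ?f w"
  have sub: "cball z r \<subseteq> cball z r0" using r(2) by auto
  have der: "(?f has_derivative ?E w) (at w)" if w: "w \<in> cball z r0" for w
  proof -
    obtain q where q: "q \<in> fst c" "w = snd c q" using r0(2) w by auto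
    then show ?thesis
      using N c(1) chart_open(3)[OF A c(1)] unfolding parallel_endo_def by simp
  qed
  have bound: "norm (?E w v) \<le> B * norm (?f w) * norm v" if w: "w \<in> cball z r0" for w v
  proof -
    have "norm (?E w v) \<le> K * K0 w * norm (?f w) * norm v"
      using K(2) unfolding K0_def by blast
    also have "\<dots> \<le> B * norm (?f w) * norm v"
      using B(2)[OF w] by (intro mult_right_mono) auto
    finally show ?thesis .
  qed
  have "continuous_on (cball z r) ?f"
  proof (rule has_derivative_continuous_on)
    show "(?f has_derivative ?E w) (at w within cball z r)" if "w \<in> cball z r" for w
      using has_derivative_at_withinI[OF der] that sub by blast
  qed
  then have "continuous_on (cball z r) (\<lambda>w. norm (?f w))" by (rule continuous_on_norm)
  then obtain w1 where w1: "w1 \<in> cball z r" "\<And>w. w \<in> cball z r \<Longrightarrow> norm (?f w) \<le> norm (?f w1)"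
    using continuous_attains_sup[OF compact_cball, of z r "\<lambda>w. norm (?f w)"] r(1) by fastforce
  have "norm (?f w1 - ?f z) \<le> (B * norm (?f w1)) * norm (w1 - z)"
  proof (rule differentiable_bound[OF convex_cball, of z r ?f ?E])
    show "(?f has_derivative ?E w) (at w within cball z r)" if "w \<in> cball z r" for w
      using has_derivative_at_withinI[OF der] that sub by blast
    show "onorm (?E w) \<le> B * norm (?f w1)" if w: "w \<in> cball z r" for w
    proof (rule onorm_le)
      fix v
      have "norm (?E w v) \<le> B * norm (?f w) * norm v" using bound sub w by blast
      also have "\<dots> \<le> B * norm (?f w1) * norm v"
        using w1(2)[OF w] Bpos by (intro mult_right_mono mult_left_mono) auto
      finally show "norm (?E w v) \<le> B * norm (?f w1) * norm v" .
    qed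
  qed (use w1(1) r(1) in auto)
  also have "\<dots> \<le> (B * norm (?f w1)) * r"
    using w1(1) Bpos by (intro mult_left_mono) (auto simp: dist_norm norm_minus_commute)
  also have "\<dots> = (B * r) * norm (?f w1)" by simp
  also have "\<dots> \<le> 1/2 * norm (?f w1)" using r(3) by (rule mult_right_mono) simp
  \<comment> \<open>The maximum of the norm on the disc is at most half of itself, hence
    zero.\<close>
  finally have "norm (?f w1) \<le> 1/2 * norm (?f w1)"
    using zero c(2) chart_open(3)[OF A c(1)] by (simp add: z_def)
  then have f0: "?f w = 0" if "w \<in> cball z r" for w
    using w1(2)[OF that] norm_ge_zero[of "?f w"] by simp
  show ?thesis
  proof (rule eventually_mono[OF chart_nhd[OF A c open_ball, of z r]])
    show "snd c p \<in> ball z r" using r(1) by (simp add: z_def)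
    show "N q = 0" if "q \<in> fst c \<and> snd c q \<in> ball z r" for q
      using f0[of "snd c q"] that chart_open(3)[OF A c(1)] by simp
  qed
qed

text \<open>The zero set is open by \<open>parallel_zero_open\<close> and closed by continuity, so
  connectedness makes it everything.\<close>

lemma parallel_zero:
  assumes A: "riemann_surface A" and con: "connected (UNIV :: 'a::t2_space set)"
    and C: "lambda_connection A l C" and N: "parallel_endo A l C N"
    and cont: "continuous_on UNIV N" and zero: "N p0 = 0"
  shows "N (p :: 'a) = 0"
proof -
  have "(N p0 = 0) = (N p = 0)"
  proof (rule connected_local_const[OF con UNIV_I UNIV_I, of "\<lambda>p. N p = 0"], intro ballI)
    fix p
    have "eventually (\<lambda>q. (N p = 0) = (N q = 0)) (nhds p)"
    proof (cases "N p = 0")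
      case True
      then show ?thesis using parallel_zero_open[OF A C N True] by simp
    next
      case False
      have "open (N -` (- {0}))" using cont by (intro open_vimage) auto
      then have "eventually (\<lambda>q. N q \<noteq> 0) (nhds p)"
        using False by (auto simp: eventually_nhds)
      then show ?thesis using False by simp
    qed
    then show "eventually (\<lambda>q. (N p = 0) = (N q = 0)) (at p within UNIV)"
      by (simp add: eventually_at_filter eventually_mono)
  qed
  then show ?thesis using zero by simp
qed

section \<open>Kernels of parallel endomorphisms, and automorphisms of irreducible
  connections\<close>

text \<open>The generator is orthogonal, for the bilinear pairing, to the nonzero row
  \<open>i\<close>; the other row is a multiple of that row as the determinant vanishes.\<close>

lemma kernel_span:
  fixes M :: cmat
  assumes "det M = 0" "M $ i \<noteq> 0"
  shows "{w. M *v w = 0} = range (\<lambda>k. k *s vector [- M $ i $ 2, M $ i $ 1])"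
proof (intro equalityI subsetI)
  fix w :: "complex^2" assume "w \<in> {w. M *v w = 0}"
  then have "(M *v w) $ i = 0" by simp
  then have eq: "M $ i $ 1 * w $ 1 + M $ i $ 2 * w $ 2 = 0"
    by (simp add: matrix_vector_mult_def sum_2)
  have "M $ i $ 1 \<noteq> 0 \<or> M $ i $ 2 \<noteq> 0" using assms(2) by (simp add: vec_eq_iff forall_2)
  then show "w \<in> range (\<lambda>k. k *s vector [- M $ i $ 2, M $ i $ 1])"
  proof
    assume "M $ i $ 1 \<noteq> 0"
    then show ?thesis using eq
      by (intro range_eqI[of _ _ "w $ 2 / M $ i $ 1"])
        (simp add: mat2_simps field_simps eq_neg_iff_add_eq_0)
  next
    assume "M $ i $ 2 \<noteq> 0"
    then show ?thesis using eq
      by (intro range_eqI[of _ _ "- w $ 1 / M $ i $ 2"])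
        (simp add: mat2_simps field_simps eq_neg_iff_add_eq_0)
  qed
next
  fix w :: "complex^2" assume "w \<in> range (\<lambda>k. k *s vector [- M $ i $ 2, M $ i $ 1])"
  then obtain k where w: "w = k *s vector [- M $ i $ 2, M $ i $ 1]" by blast
  have "M $ 1 $ 1 * M $ 2 $ 2 = M $ 1 $ 2 * M $ 2 $ 1" using assms(1) by (simp add: det_2)
  moreover have "i = 1 \<or> i = 2" using exhaust_2 by blast
  ultimately show "w \<in> {w. M *v w = 0}"
    unfolding w by (auto simp: mat2_simps algebra_simps)
qed

text \<open>Where row \<open>i\<close> is nonzero, \<open>kernel_span\<close> gives a frame
  depending linearly on \<open>N\<close>, so it is smooth.\<close>

lemma kernel_line_subbundle:
  assumes A: "riemann_surface A" and N: "smooth_on A UNIV N"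
    and "\<And>p. det (N p) = 0" "\<And>p. N p \<noteq> 0"
  shows "line_subbundle A (\<lambda>p. {w. N p *v w = 0})"
  unfolding line_subbundle_def
proof
  fix p
  obtain i where i: "N p $ i \<noteq> 0" using assms(4)[of p] by (auto simp: vec_eq_iff[of "N p"])
  define V where "V = {q. N q $ i \<noteq> 0}"
  define T :: "cmat \<Rightarrow> complex^2" where "T = (\<lambda>M. vector [- M $ i $ 2, M $ i $ 1])"
  have T: "bounded_linear T"
    unfolding linear_conv_bounded_linear[symmetric] T_def
    by (intro linearI) (simp_all add: vec_eq_iff forall_2)
  have "continuous_on UNIV (\<lambda>q. N q $ i)"
    by (intro continuous_intros smooth_on_continuous[OF A N])
  then have "open ((\<lambda>q. N q $ i) -` (- {0}))" by (intro open_vimage) auto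
  then have V: "open V" by (simp add: V_def vimage_def)
  have "smooth_on A V (\<lambda>q. T (N q) + 0)"
    using smooth_on_affine[OF A V smooth_on_subset[OF A V _ N] T, of 0] by simp
  moreover have "T (N q) \<noteq> 0 \<and> {w. N q *v w = 0} = range (\<lambda>k. k *s T (N q))" if "q \<in> V" for q
    using kernel_span[OF assms(3), of q i] that
    by (auto simp: V_def T_def vec_eq_iff forall_2)
  ultimately show "\<exists>V v. open V \<and> p \<in> V \<and> smooth_on A V v \<and>
      (\<forall>q\<in>V. v q \<noteq> 0 \<and> {w. N q *v w = 0} = range (\<lambda>k. k *s v q))"
    using V i by (intro exI[of _ V] exI[of _ "\<lambda>q. T (N q)"]) (auto simp: V_def)
qed

text \<open>Differentiating \<open>N \<sigma> = 0\<close> and inserting the equation for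
  \<open>N\<close> shows that \<open>N\<close> annihilates the covariant derivative of
  \<sigma>.\<close>

lemma kernel_preserved:
  assumes A: "riemann_surface A" and N: "parallel_endo A l (\<alpha>, \<beta>) N" and l: "l \<noteq> 0"
  shows "preserves A (dbar_op \<alpha>) (\<lambda>p. {w. N p *v w = 0})"
    and "preserves A (D_op l \<beta>) (\<lambda>p. {w. N p *v w = 0})"
proof -
  have "dbar_op \<alpha> c \<sigma> q \<in> {w. N q *v w = 0} \<and> D_op l \<beta> c \<sigma> q \<in> {w. N q *v w = 0}"
    if V: "open V" "smooth_on A V \<sigma>" "\<forall>q\<in>V. \<sigma> q \<in> {w. N q *v w = 0}" and c: "c \<in> A" "q \<in> V \<inter> fst c"
    for V \<sigma> c q
  proof -
    obtain F where F: "((\<sigma> \<circ> chart_inv c) has_derivative F) (at (snd c q))"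
      using smooth_on_has_derivative[OF V(2) c(1)] c(2) by auto
    define B where "B = conn_mat l (\<alpha>, \<beta>) c q"
    have "((N \<circ> chart_inv c) has_derivative (\<lambda>v. N q ** B v - B v ** N q)) (at (snd c q))"
      using N c unfolding parallel_endo_def B_def by auto
    from bounded_bilinear.FDERIV[OF bilinear_mv this F]
    have "((\<lambda>w. N (chart_inv c w) *v \<sigma> (chart_inv c w)) has_derivative
        (\<lambda>v. N q *v F v + (N q ** B v - B v ** N q) *v \<sigma> q)) (at (snd c q))"
      using c chart_open(3)[OF A c(1)] by simp
    then have "((\<lambda>w. 0) has_derivative
        (\<lambda>v. N q *v F v + (N q ** B v - B v ** N q) *v \<sigma> q)) (at (snd c q))"
    proof (rule has_derivative_transform_within_open[OF _ open_chart_image[OF A c(1) V(1)]])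
      show "snd c q \<in> snd c ` (V \<inter> fst c)" using c(2) by blast
      show "N (chart_inv c w) *v \<sigma> (chart_inv c w) = 0" if "w \<in> snd c ` (V \<inter> fst c)" for w
        using that V(3) chart_open(3)[OF A c(1)] by auto
    qed
    then have "(\<lambda>v. N q *v F v + (N q ** B v - B v ** N q) *v \<sigma> q) = (\<lambda>v. 0)"
      using has_derivative_unique has_derivative_const by blast
    then have d: "N q *v F v + (N q ** B v - B v ** N q) *v \<sigma> q = 0" for v by metis
    have ker: "N q *v \<sigma> q = 0" using V(3) c(2) by auto
    \<comment> \<open>This is the covariant derivative of \<sigma> in direction \<open>v\<close>;
      both operators are combinations of its values at 1 and \<open>\<i>\<close>.\<close>
    define X where "X = (\<lambda>v. F v + B v *v \<sigma> q)"
    have X: "N q *v X v = 0" for v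
    proof -
      have "N q *v X v = (N q *v F v + (N q ** B v - B v ** N q) *v \<sigma> q) + B v *v (N q *v \<sigma> q)"
        unfolding X_def matrix_vector_mul_assoc
        by (simp add: matrix_vector_right_distrib matrix_vector_mult_diff_rdistrib
          matrix_vector_mul_assoc)
      then show ?thesis by (simp add: d ker)
    qed
    have db: "dbar_op \<alpha> c \<sigma> q = (1/2) *s (X 1 + \<i> *s X \<i>)"
      by (simp add: dbar_op_def wirtinger_eq[OF F] X_def B_def conn_mat_def mat2_simps field_simps)
    have D: "D_op l \<beta> c \<sigma> q = (l/2) *s (X 1 + (- \<i>) *s X \<i>)"
      using l by (simp add: D_op_def wirtinger_eq[OF F] X_def B_def conn_mat_def mat2_simps field_simps)
    have "N q *v (a *s (X 1 + b *s X \<i>)) = a *s (N q *v X 1 + b *s (N q *v X \<i>))" for a b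
      by (simp add: mat2_simps algebra_simps)
    then have "N q *v (a *s (X 1 + b *s X \<i>)) = 0" for a b
      by (simp add: X)
    then show ?thesis unfolding db D by blast
  qed
  then show "preserves A (dbar_op \<alpha>) (\<lambda>p. {w. N p *v w = 0})"
    and "preserves A (D_op l \<beta>) (\<lambda>p. {w. N p *v w = 0})"
    unfolding preserves_def by blast+
qed

text \<open>Trace and determinant of \<open>h\<close> are constant, so \<open>h\<close> has a
  constant eigenvalue \<open>k\<close>. If \<open>h - k\<close> vanished nowhere, its kernel would
  be an invariant holomorphic line subbundle; so it vanishes somewhere and, being parallel,
  everywhere.\<close>

lemma irreducible_automorphism_scalar:
  assumes A: "riemann_surface A" and con: "connected (UNIV :: 'a::t2_space set)"
    and irr: "irreducible_lambda_connection A l C" and l: "l \<noteq> 0"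
    and h: "smooth_on A UNIV h" "\<And>p :: 'a. h p \<in> SL2" "gauge_by A l h C C"
  obtains k where "k\<^sup>2 = 1" "\<And>p. h p = mat k"
proof -
  obtain \<alpha> \<beta> where C: "C = (\<alpha>, \<beta>)" by (metis prod.exhaust)
  have conn: "lambda_connection A l C" using irr by (simp add: irreducible_lambda_connection_def)
  note par = automorphism_parallel[OF A l h]
  define t where "t = trace (h undefined)"
  have t: "trace (h p) = t" for p unfolding t_def by (rule parallel_trace_const[OF A con par])
  \<comment> \<open>A root of the characteristic polynomial, whose constant term is the determinant
    1.\<close>
  define k where "k = (t + csqrt (t\<^sup>2 - 4)) / 2"
  have "k\<^sup>2 - t * k + 1 = ((csqrt (t\<^sup>2 - 4))\<^sup>2 - t\<^sup>2 + 4) / 4"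
    unfolding k_def by (simp add: power2_eq_square field_simps)
  then have k: "k\<^sup>2 - t * k + 1 = 0" by simp
  define N where "N = (\<lambda>p. h p - mat k)"
  have Npar: "parallel_endo A l C N" unfolding N_def by (rule parallel_endo_diff_mat[OF par])
  have det: "det (N p) = 0" for p
  proof -
    have "det (h p) = 1" using h(2)[of p] by (simp add: SL2_def)
    then have "det (N p) = k\<^sup>2 - trace (h p) * k + 1"
      by (simp add: N_def det_2 mat2_simps power2_eq_square algebra_simps)
    then show ?thesis using k t by simp
  qed
  have smooth: "smooth_on A UNIV N"
    using smooth_on_affine[OF A open_UNIV h(1) bounded_linear_ident, of "- mat k"] by (simp add: N_def)
  have "\<exists>p. N p = 0"
  proof (rule ccontr)
    assume "\<nexists>p. N p = 0"
    then have "line_subbundle A (\<lambda>p. {w. N p *v w = 0})"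
      by (intro kernel_line_subbundle[OF A smooth det]) auto
    then show False
      using irr kernel_preserved[OF A Npar[unfolded C] l]
      unfolding irreducible_lambda_connection_def holomorphic_line_subbundle_def C by blast
  qed
  then obtain p0 where "N p0 = 0" by blast
  then have "N p = 0" for p
    by (rule parallel_zero[OF A con conn Npar smooth_on_continuous[OF A smooth]])
  then have hk: "h p = mat k" for p by (simp add: N_def)
  moreover have "k\<^sup>2 = 1"
    using h(2)[of undefined] by (simp add: hk SL2_def det_2 mat_def power2_eq_square)
  ultimately show ?thesis using that by blast
qed

section \<open>The sign\<close>

text \<open>A constant matrix commutes with differentiation, so only the coefficients have to be
  intertwined.\<close>

lemma gauge_by_const:
  assumes A: "riemann_surface A" and U: "U \<in> SL2"
    and "\<And>c p. c \<in> A \<Longrightarrow> p \<in> fst c \<Longrightarrow>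
      U ** fst C' c p = fst C c p ** U \<and> U ** snd C' c p = snd C c p ** U"
  shows "gauge_by A l (\<lambda>p. U) C C'"
proof -
  obtain \<alpha> \<beta> \<alpha>' \<beta>' where C: "C = (\<alpha>, \<beta>)" "C' = (\<alpha>', \<beta>')" by (metis prod.exhaust)
  have "U *v dbar_op \<alpha>' c \<sigma> p = dbar_op \<alpha> c (\<lambda>q. U *v \<sigma> q) p \<and>
      U *v D_op l \<beta>' c \<sigma> p = D_op l \<beta> c (\<lambda>q. U *v \<sigma> q) p"
    if s: "smooth_on A UNIV \<sigma>" and c: "c \<in> A" "p \<in> fst c" for \<sigma> c p
  proof -
    obtain F where F: "((\<sigma> \<circ> chart_inv c) has_derivative F) (at (snd c p))"
      using smooth_on_has_derivative[OF s c(1) UNIV_I c(2)] .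
    have UF: "(((\<lambda>q. U *v \<sigma> q) \<circ> chart_inv c) has_derivative (\<lambda>v. U *v F v)) (at (snd c p))"
      using bounded_linear.has_derivative[OF bounded_bilinear.bounded_linear_right[OF bilinear_mv] F]
      by (simp add: comp_def)
    have "U ** \<alpha>' c p = \<alpha> c p ** U" "U ** \<beta>' c p = \<beta> c p ** U"
      using assms(3)[OF c] by (auto simp: C)
    then have "U *v (\<alpha>' c p *v \<sigma> p) = \<alpha> c p *v (U *v \<sigma> p)"
      "U *v (\<beta>' c p *v \<sigma> p) = \<beta> c p *v (U *v \<sigma> p)"
      by (simp_all add: matrix_vector_mul_assoc)
    moreover have "U *v ((1/2) *s (F 1 + \<i> *s F \<i>)) = (1/2) *s (U *v F 1 + \<i> *s (U *v F \<i>))"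
      "U *v (l *s ((1/2) *s (F 1 - \<i> *s F \<i>))) = l *s ((1/2) *s (U *v F 1 - \<i> *s (U *v F \<i>)))"
      by (simp_all add: mat2_simps algebra_simps)
    ultimately show ?thesis
      by (simp only: dbar_op_def D_op_def wirtinger_eq[OF F] wirtinger_eq[OF UF]
        matrix_vector_right_distrib)
  qed
  then show ?thesis
    unfolding gauge_by_def C prod.case matrix_inv_SL2_eq_iff[OF U] by blast
qed

lemma quat_unit_SL2: "quat_unit \<in> SL2"
  by (simp add: quat_unit_def SL2_def det_2)

text \<open>Moving \<open>quat_unit\<close> past a conjugate matrix produces
  \<open>quat_mat\<close>. The minus sign of the antipode cancels against the one in
  \<open>quat_mat \<phi> = - adj_mat \<phi>\<close>.\<close>

lemma tau_gauge_quat_unit: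
  assumes A: "riemann_surface A" and S: "sd_solution A S"
  shows "tau_gauge A (hodge S) (\<lambda>l p. quat_unit)"
proof -
  obtain \<alpha> \<beta> \<phi> where Seq: "S = (\<alpha>, \<beta>, \<phi>)" by (metis prod.exhaust)
  have J: "quat_unit ** conj_mat M = quat_mat M ** quat_unit" for M
    by (simp add: quat_unit_def quat_mat_def mat2_simps)
  note lin = linear_add[OF bounded_linear.linear[OF bounded_linear_quat_mat]]
  have "gauge_by A 1 (\<lambda>p. quat_unit) (flat_family (hodge S) l)
      (conj_conn (flat_family (hodge S) (- inverse (cnj l))))" if l: "l \<noteq> 0" for l
  proof (rule gauge_by_const[OF A quat_unit_SL2])
    fix c p assume c: "c \<in> A" "p \<in> fst c"
    have u: "quat_mat (\<alpha> c p) = \<beta> c p" "quat_mat (\<phi> c p) = - adj_mat (\<phi> c p)"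
      using sd_solution_unitary_pair[OF S] c unfolding unitary_pair_def Seq by auto
    then have u': "quat_mat (\<beta> c p) = \<alpha> c p" "quat_mat (adj_mat (\<phi> c p)) = - \<phi> c p"
      using quat_mat_quat_mat[of "\<phi> c p"] linear_neg[OF bounded_linear.linear[OF bounded_linear_quat_mat]]
      by (metis quat_mat_quat_mat, metis minus_minus)
    have F: "flat_family (hodge S) m = (\<lambda>c p. \<alpha> c p + cscale m (adj_mat (\<phi> c p)),
        \<lambda>c p. \<beta> c p + cscale (inverse m) (\<phi> c p))" if "m \<noteq> 0" for m
      using that by (simp add: Seq flat_family_def hodge_def add_form_def scale_form_def adj_form_def
        fun_eq_iff) (simp add: mat2_simps field_simps)
    have m: "- inverse (cnj l) \<noteq> 0" using l by simp
    have neg: "cscale (- k) (- M) = cscale k M" for k M by (simp add: mat2_simps)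
    show "quat_unit ** fst (conj_conn (flat_family (hodge S) (- inverse (cnj l)))) c p =
          fst (flat_family (hodge S) l) c p ** quat_unit \<and>
        quat_unit ** snd (conj_conn (flat_family (hodge S) (- inverse (cnj l)))) c p =
          snd (flat_family (hodge S) l) c p ** quat_unit"
      by (simp add: F[OF l] F[OF m] conj_conn_def J lin quat_mat_cscale u u' neg)
  qed
  moreover have "holomorphic_gauge_family A (- {0}) (\<lambda>l p. quat_unit)"
    using chart_open(2)[OF A]
    by (auto simp: holomorphic_gauge_family_def holomorphic_form_family_def case_prod_unfold
      intro!: Cinf_on_const open_Times)
  ultimately show ?thesis by (simp add: tau_gauge_def quat_unit_SL2)
qed

text \<open>Joint smoothness is restricted to the slice with fixed parameter, an affine embedding of
  the chart image.\<close>

lemma holomorphic_gauge_family_smooth: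
  assumes A: "riemann_surface A" and g: "holomorphic_gauge_family A W g" and l: "l \<in> W"
  shows "smooth_on A UNIV (g l)"
  unfolding smooth_on_def
proof
  fix c assume c: "c \<in> A"
  let ?S = "snd c ` (UNIV \<inter> fst c)"
  have o: "open ?S" by (rule open_chart_image[OF A c open_UNIV])
  have f: "Cinf_on (W \<times> snd c ` fst c) (\<lambda>(l, z). g l (chart_inv c z))"
    using g c by (auto simp: holomorphic_gauge_family_def holomorphic_form_family_def)
  have T: "bounded_linear (\<lambda>z :: complex. (0 :: complex, z))"
    by (intro bounded_linear_Pair bounded_linear_zero bounded_linear_ident)
  have "Cinf_on ?S (\<lambda>x. (\<lambda>(l, z). g l (chart_inv c z)) ((l, 0) + (0, x)) + 0)"
    by (rule Cinf_on_affine[where Q = "\<lambda>x. x", OF f o T bounded_linear_ident]) (use l in auto)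
  then show "Cinf_on ?S (g l \<circ> chart_inv c)" by (simp add: comp_def)
qed

text \<open>Passes from the flat connection back to the \<open>l\<close>-connection, for which
  irreducibility is formulated.\<close>

lemma gauge_by_scale:
  assumes "gauge_by A 1 g (flat_family F l) (flat_family G l)" "l \<noteq> 0"
  shows "gauge_by A l g (F l) (G l)"
proof -
  have D: "D_op l \<beta> c \<sigma> p = l *s D_op 1 (scale_form (inverse l) \<beta>) c \<sigma> p" for \<beta> c \<sigma> p
    using assms(2) by (simp add: D_op_def scale_form_def mat2_simps field_simps)
  have lin: "M *v (l *s v) = l *s (M *v v)" for M :: cmat and v
    by (simp add: mat2_simps algebra_simps)
  obtain \<alpha> \<beta> \<alpha>' \<beta>' where "F l = (\<alpha>, \<beta>)" "G l = (\<alpha>', \<beta>')" by (metis prod.exhaust)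
  then show ?thesis
    using assms(1) by (simp add: gauge_by_def flat_family_def D lin)
qed

text \<open>Following \<open>g\<close> by the inverse of \<open>U\<close> gives an automorphism of
  \<open>C\<close>. As \<open>U\<close> is constant, its inverse \<open>V\<close> maps smooth test
  sections to smooth ones by linearity.\<close>

lemma gauge_by_cancel:
  assumes A: "riemann_surface A" and g: "\<And>p. g p \<in> SL2" "gauge_by A l g C C'"
    and U: "U \<in> SL2" "V ** U = mat 1" "gauge_by A l (\<lambda>p. U) C C'"
  shows "gauge_by A l (\<lambda>p. g p ** V) C C"
proof -
  obtain \<alpha> \<beta> \<alpha>' \<beta>' where C: "C = (\<alpha>, \<beta>)" "C' = (\<alpha>', \<beta>')" by (metis prod.exhaust)
  have UV: "U ** V = mat 1" using U(2) matrix_left_right_inverse by blast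
  have "det V * det U = 1" using U(2) det_mul[of V U] by simp
  then have V: "V \<in> SL2" using U(1) by (simp add: SL2_def)
  have gV: "g p ** V \<in> SL2" for p using g(1)[of p] V by (simp add: SL2_def det_mul)
  have "(g p ** V) *v dbar_op \<alpha> c \<sigma> p = dbar_op \<alpha> c (\<lambda>q. (g q ** V) *v \<sigma> q) p \<and>
      (g p ** V) *v D_op l \<beta> c \<sigma> p = D_op l \<beta> c (\<lambda>q. (g q ** V) *v \<sigma> q) p"
    if s: "smooth_on A UNIV \<sigma>" and c: "c \<in> A" "p \<in> fst c" for \<sigma> c p
  proof -
    have s': "smooth_on A UNIV (\<lambda>q. V *v \<sigma> q)"
      using smooth_on_affine[OF A open_UNIV s bounded_bilinear.bounded_linear_right[OF bilinear_mv], of V 0]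
      by simp
    have "g p *v dbar_op \<alpha>' c (\<lambda>q. V *v \<sigma> q) p = dbar_op \<alpha> c (\<lambda>q. g q *v (V *v \<sigma> q)) p"
      "g p *v D_op l \<beta>' c (\<lambda>q. V *v \<sigma> q) p = D_op l \<beta> c (\<lambda>q. g q *v (V *v \<sigma> q)) p"
      using g(2) s' c unfolding gauge_by_def C prod.case matrix_inv_SL2_eq_iff[OF g(1)] by blast+
    moreover have U': "U *v dbar_op \<alpha>' c (\<lambda>q. V *v \<sigma> q) p = dbar_op \<alpha> c (\<lambda>q. U *v (V *v \<sigma> q)) p"
      "U *v D_op l \<beta>' c (\<lambda>q. V *v \<sigma> q) p = D_op l \<beta> c (\<lambda>q. U *v (V *v \<sigma> q)) p"
      using U(3) s' c unfolding gauge_by_def C prod.case matrix_inv_SL2_eq_iff[OF U(1)] by blast+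
    have UVx: "U *v (V *v x) = x" and VUx: "V *v (U *v x) = x" for x
      using U(2) UV by (simp_all add: matrix_vector_mul_assoc)
    have "dbar_op \<alpha>' c (\<lambda>q. V *v \<sigma> q) p = V *v dbar_op \<alpha> c \<sigma> p"
      "D_op l \<beta>' c (\<lambda>q. V *v \<sigma> q) p = V *v D_op l \<beta> c \<sigma> p"
      using arg_cong[OF U'(1), of "(*v) V"] arg_cong[OF U'(2), of "(*v) V"]
      unfolding UVx VUx by simp_all
    ultimately show ?thesis by (simp add: matrix_vector_mul_assoc)
  qed
  then show ?thesis
    unfolding gauge_by_def C prod.case matrix_inv_SL2_eq_iff[OF gV] by blast
qed

text \<open>The quotient of \<open>g l\<close> by \<open>quat_unit\<close> is an automorphism of an
  irreducible connection, hence a scalar of square 1.\<close>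

lemma tau_gauge_unique:
  assumes A: "riemann_surface A" and con: "connected (UNIV :: 'a::t2_space set)"
    and S: "sd_solution A S"
    and irr: "\<forall>l. l \<noteq> 0 \<longrightarrow> irreducible_lambda_connection A l (hodge S l)"
    and g: "tau_gauge A (hodge S) g" and l: "l \<noteq> 0"
  obtains k where "k\<^sup>2 = 1" "\<And>p :: 'a. g l p = mat k ** quat_unit"
proof -
  have gl: "smooth_on A UNIV (g l)" "\<And>p. g l p \<in> SL2"
      "gauge_by A 1 (g l) (flat_family (hodge S) l) (conj_conn (flat_family (hodge S) (- inverse (cnj l))))"
    using g l holomorphic_gauge_family_smooth[OF A, of "- {0}" g l] by (auto simp: tau_gauge_def)
  have J: "gauge_by A 1 (\<lambda>p. quat_unit) (flat_family (hodge S) l)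
      (conj_conn (flat_family (hodge S) (- inverse (cnj l))))"
    using tau_gauge_quat_unit[OF A S] l by (simp add: tau_gauge_def)
  \<comment> \<open>Since \<open>quat_unit\<close> squares to -1, its inverse is its
    negative.\<close>
  have inv: "(- quat_unit) ** quat_unit = mat 1"
    by (simp add: quat_unit_def mat2_simps)
  define h where "h = (\<lambda>p. g l p ** (- quat_unit))"
  have "gauge_by A 1 h (flat_family (hodge S) l) (flat_family (hodge S) l)"
    unfolding h_def by (rule gauge_by_cancel[OF A gl(2,3) quat_unit_SL2 inv J])
  then have aut: "gauge_by A l h (hodge S l) (hodge S l)"
    using l by (rule gauge_by_scale)
  have "smooth_on A UNIV h"
    using smooth_on_affine[OF A open_UNIV gl(1) bounded_bilinear.bounded_linear_left[OF bilinear_mm], of "- quat_unit" 0]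
    by (simp add: h_def)
  moreover have "h p \<in> SL2" for p
  proof -
    have "det (- quat_unit) = 1" by (simp add: quat_unit_def det_2)
    then show ?thesis using gl(2)[of p] by (simp add: h_def SL2_def det_mul)
  qed
  ultimately obtain k where k: "k\<^sup>2 = 1" "\<And>p. h p = mat k"
    using irreducible_automorphism_scalar[OF A con irr[rule_format, OF l] l _ _ aut] by metis
  have "g l p = h p ** quat_unit" for p
    unfolding h_def matrix_mul_assoc[symmetric] inv by simp
  then show ?thesis using that k by auto
qed

text \<open>The scalar is continuous in the parameter with values 1 and -1 on the connected
  punctured plane, so it agrees at antipodal points; its square drops out and the square of the real
  matrix \<open>quat_unit\<close> remains.\<close>

lemma tau_gauge_sign:
  assumes A: "riemann_surface A" and con: "connected (UNIV :: 'a::t2_space set)"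
    and S: "sd_solution A S"
    and irr: "\<forall>l. l \<noteq> 0 \<longrightarrow> irreducible_lambda_connection A l (hodge S l)"
    and g: "tau_gauge A (hodge S) g" and l: "l \<noteq> 0"
  shows "g l p ** conj_mat (g (- inverse (cnj l)) (p :: 'a)) = mat (- 1)"
proof -
  \<comment> \<open>This entry of \<open>quat_unit\<close> is 1, so it reads off the scalar as a
    holomorphic function of the parameter.\<close>
  let ?f = "\<lambda>l. g l p $ 1 $ 2"
  have f: "(?f m)\<^sup>2 = 1 \<and> g m p = mat (?f m) ** quat_unit" if "m \<noteq> 0" for m
  proof -
    obtain k where k: "k\<^sup>2 = 1" "g m p = mat k ** quat_unit" using tau_gauge_unique[OF A con S irr g \<open>m \<noteq> 0\<close>] by metis
    then have "?f m = k" by (simp add: quat_unit_def mat2_simps)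
    then show ?thesis using k by simp
  qed
  obtain c where c: "c \<in> A" "p \<in> fst c" using chart_exists[OF A] .
  have "continuous_on (- {0}) ?f"
    using g c by (auto simp: tau_gauge_def holomorphic_gauge_family_def holomorphic_form_family_def
      intro!: holomorphic_on_imp_continuous_on)
  moreover have "connected (- {0 :: complex})"
    by (rule connected_punctured_universe) simp
  moreover have "finite (?f ` (- {0}))"
    by (rule finite_subset[of _ "{1, -1}"]) (use f in \<open>auto simp: power2_eq_1_iff\<close>)
  ultimately have "?f constant_on (- {0})"
    by (intro continuous_finite_range_constant)
  moreover have "- inverse (cnj l) \<noteq> 0" using l by simp
  ultimately have eq: "?f (- inverse (cnj l)) = ?f l"
    using l unfolding constant_on_def by (metis ComplI singletonD)
  define k where "k = ?f l"
  have gk: "g l p = mat k ** quat_unit" "g (- inverse (cnj l)) p = mat k ** quat_unit"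
    using f[OF l] f[of "- inverse (cnj l)"] l eq by (auto simp: k_def)
  have "k = 1 \<or> k = -1" using f[OF l] by (simp add: k_def power2_eq_1_iff)
  then show ?thesis
    unfolding gk by (auto simp: quat_unit_def mat2_simps)
qed

theorem proposition3p3:
  fixes A :: "'a::t2_space chart set"
    and s :: "cp1 \<Rightarrow> 'a pair set \<times> cp1"
  assumes "compact_connected_riemann_surface A"
    and "genus A \<ge> 2"
    and "irreducible_section A s"
    and "preferred_section A s"
  shows "tau_negative A s"
proof -
  have A: "riemann_surface A" and con: "connected (UNIV :: 'a set)"
    using assms(1) by (auto simp: compact_connected_riemann_surface_def)
  have real: "tau_real A s" using assms(4) by (simp add: preferred_section_def)
  obtain S where S: "sd_solution A S" "lift_on A s UNIV (hodge S)"
    using assms(4) by (auto simp: preferred_section_def)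
  \<comment> \<open>The lift represents \<open>s\<close> at every parameter, and irreducibility of
    the section applies to all representatives.\<close>
  have irr: "\<forall>l. l \<noteq> 0 \<longrightarrow> irreducible_lambda_connection A l (hodge S l)"
    using assms(3) S(2) unfolding irreducible_section_def lift_on_def by blast
  have "has_tau_sign A s (- 1)"
    unfolding has_tau_sign_def
    using S(2) tau_gauge_quat_unit[OF A S(1)] tau_gauge_sign[OF A con S(1) irr] by blast
  then show ?thesis
    using assms(3) real hodge_parity[OF A S(1) real S(2)] by (simp add: tau_negative_def)
qed

end
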